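(* Let $f\in L^1_{loc}([0,\infty);\mathbb{R})$, let $a>0$ and $b>0$ be real constants, and for $(\xi_0,\xi_1)\in\mathbb{R}^2$ let $x(\cdot;\xi_0,\xi_1)$ be the unique continuous solution on $[0,\infty)$ of $$x''(t)+ax'(t)+bx(t)=f(t),\quad t\ge 0;\qquad x(0)=\xi_0,\ x'(0)=\xi_1.$$ Let $$y_1(t)=\int_0^t e^{-(t-s)}f(s)\,ds,\qquad f_\theta(t)=\int_{(t-\theta)^+}^t f(s)\,ds,\qquad t\ge 0,\ \theta\in[0,1].$$ Then the following are equivalent: (i) For every $(\xi_0,\xi_1)\in\mathbb{R}^2$, $x(t;\xi_0,\xi_1)\to 0$ and $x'(t;\xi_0,\xi_1)\to 0$ as $t\to\infty$; (ii) $y_1(t)\to 0$ as $t\to\infty$; (iii) $f_\theta(t)\to 0$ as $t\to\infty$ uniformly in $\theta\in[0,1]$; (iv) $f_\theta(t)\to 0$ as $t\to\infty$ for each $\theta\in[0,1]$.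
   Context: $u^+=\max(u,0)$. Since $f$ is only locally integrable, a solution of the differential equation is a function $x\in C^1([0,\infty);\mathbb{R})$ with $x'$ locally absolutely continuous, satisfying the equation for almost every $t\ge 0$ and the given initial conditions. *)

theory Defs
  imports "HOL-Analysis.Analysis"
begin

definition L1_loc :: "real set \<Rightarrow> (real \<Rightarrow> real) set" where
  "L1_loc S = {f. \<forall>K. compact K \<and> K \<subseteq> S \<longrightarrow> f absolutely_integrable_on K}"

(* The usual epsilon-delta definition on an interval S. The set D ranges over the finite
   families of non-overlapping compact intervals contained in S, and for K = {l..r} the
   summands are r - l and |g r - g l|. *)
definition abs_continuous_on :: "real set \<Rightarrow> (real \<Rightarrow> real) \<Rightarrow> bool" where
  "abs_continuous_on S g \<longleftrightarrow>
     (\<forall>\<epsilon>>0. \<exists>\<delta>>0. \<forall>D. D division_of \<Union>D \<and> \<Union>D \<subseteq> S \<and> (\<Sum>K\<in>D. Sup K - Inf K) < \<delta> \<longrightarrow>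
        (\<Sum>K\<in>D. \<bar>g (Sup K) - g (Inf K)\<bar>) < \<epsilon>)"

definition locally_abs_continuous_on :: "real set \<Rightarrow> (real \<Rightarrow> real) \<Rightarrow> bool" where
  "locally_abs_continuous_on S g \<longleftrightarrow> (\<forall>c d. {c..d} \<subseteq> S \<longrightarrow> abs_continuous_on {c..d} g)"

(* Derivative of a function on [0,\<infinity>), one-sided at 0. It is only meaningful at points where
   the function is differentiable within {0..}. *)
definition deriv_ge0 :: "(real \<Rightarrow> real) \<Rightarrow> real \<Rightarrow> real" where
  "deriv_ge0 x t = vector_derivative x (at t within {0..})"

definition is_solution ::
  "(real \<Rightarrow> real) \<Rightarrow> real \<Rightarrow> real \<Rightarrow> real \<Rightarrow> real \<Rightarrow> (real \<Rightarrow> real) \<Rightarrow> bool" where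
  "is_solution f a b \<xi>0 \<xi>1 x \<longleftrightarrow>
     x differentiable_on {0..} \<and>
     continuous_on {0..} (deriv_ge0 x) \<and>
     locally_abs_continuous_on {0..} (deriv_ge0 x) \<and>
     (AE t\<in>{0..} in lebesgue. \<exists>x''. (deriv_ge0 x has_real_derivative x'') (at t within {0..}) \<and>
        x'' + a * deriv_ge0 x t + b * x t = f t) \<and>
     x 0 = \<xi>0 \<and> deriv_ge0 x 0 = \<xi>1"

(* The solution is a function on [0,\<infinity>). Its values at negative arguments are fixed to be 0, so
   that uniqueness on [0,\<infinity>) becomes uniqueness as a HOL function; is_solution does not
   depend on these values. *)
definition ode_solution ::
  "(real \<Rightarrow> real) \<Rightarrow> real \<Rightarrow> real \<Rightarrow> real \<Rightarrow> real \<Rightarrow> real \<Rightarrow> real" where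
  "ode_solution f a b \<xi>0 \<xi>1 = (THE x. is_solution f a b \<xi>0 \<xi>1 x \<and> (\<forall>t<0. x t = 0))"

definition y1 :: "(real \<Rightarrow> real) \<Rightarrow> real \<Rightarrow> real" where
  "y1 f t = (LINT s:{0..t}|lebesgue. exp (- (t - s)) * f s)"

definition f_theta :: "(real \<Rightarrow> real) \<Rightarrow> real \<Rightarrow> real \<Rightarrow> real" where
  "f_theta f \<theta> t = (LINT s:{max (t - \<theta>) 0..t}|lebesgue. f s)"

end

theory Submission
  imports Defs
begin

text \<open>Write \<open>F(t)\<close> for the integral of \<open>f\<close> over \<open>[0,t]\<close> and \<open>k\<close> for the solution of \<open>k' = F - k\<close>,
  \<open>k(0) = 0\<close>; then \<open>y\<^sub>1 = F - k\<close>. All the functions in question satisfy linear equations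
  \<open>z' = - c z + g\<close> with \<open>Re c > 0\<close>, for which \<open>g \<longrightarrow> 0\<close> forces \<open>z \<longrightarrow> 0\<close>. With \<open>v = x'\<close>, the function
  \<open>v - y\<^sub>1\<close> is continuously differentiable, and \<open>(x, v - y\<^sub>1)\<close> solves a stable linear system driven by
  \<open>y\<^sub>1\<close>, whose factorization over the complex numbers reduces it to scalar equations; conversely
  \<open>y\<^sub>1 - v\<close> solves a scalar equation driven by \<open>x\<close> and \<open>v\<close>. The equivalence of (ii) and (iii) follows in the
  same way from \<open>f\<^sub>\<theta>(t) = F(t) - F(t - \<theta>)\<close>, and (iv) implies (iii) by Baire's theorem, as for slowly
  varying functions.\<close>

subsection \<open>Absolutely continuous functions\<close>

lemma division_real_interval:
  fixes K :: "real set"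
  assumes "D division_of S" "K \<in> D"
  obtains l r where "K = {l..r}" "l \<le> r" "Sup K = r" "Inf K = l"
proof -
  obtain l r where "K = cbox l r"
    using division_ofD(4)[OF assms] by blast
  moreover have "K \<noteq> {}"
    using division_ofD(3)[OF assms] .
  ultimately show ?thesis
    using that[of l r] by auto
qed

text \<open>This allows the smallness condition in \<open>abs_continuous_on_def\<close> to be met by
  enclosing the cells in a set of small measure.\<close>

lemma sum_length_division:
  fixes S :: "real set"
  assumes "D division_of S"
  shows "(\<Sum>K\<in>D. Sup K - Inf K) = measure lebesgue S"
proof -
  have "(\<Sum>K\<in>D. Sup K - Inf K) = (\<Sum>K\<in>D. measure lebesgue K)"
    by (intro sum.cong refl) (metis division_real_interval[OF assms] measure_lborel_Icc measure_completion sets_lborel atLeastAtMost_borel)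
  then show ?thesis
    by (simp add: content_division[OF assms])
qed

lemma abs_continuous_on_add:
  assumes "abs_continuous_on S g" "abs_continuous_on S h"
  shows "abs_continuous_on S (\<lambda>t. g t + h t)"
  unfolding abs_continuous_on_def
proof (intro allI impI)
  fix \<epsilon> :: real assume "\<epsilon> > 0"
  then have "\<epsilon>/2 > 0" by simp
  obtain d1 where d1: "d1 > 0" "\<And>D. D division_of \<Union>D \<and> \<Union>D \<subseteq> S \<and> (\<Sum>K\<in>D. Sup K - Inf K) < d1 \<Longrightarrow>
        (\<Sum>K\<in>D. \<bar>g (Sup K) - g (Inf K)\<bar>) < \<epsilon>/2"
    using assms(1) \<open>\<epsilon>/2 > 0\<close> unfolding abs_continuous_on_def by meson
  obtain d2 where d2: "d2 > 0" "\<And>D. D division_of \<Union>D \<and> \<Union>D \<subseteq> S \<and> (\<Sum>K\<in>D. Sup K - Inf K) < d2 \<Longrightarrow>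
        (\<Sum>K\<in>D. \<bar>h (Sup K) - h (Inf K)\<bar>) < \<epsilon>/2"
    using assms(2) \<open>\<epsilon>/2 > 0\<close> unfolding abs_continuous_on_def by meson
  show "\<exists>\<delta>>0. \<forall>D. D division_of \<Union>D \<and> \<Union>D \<subseteq> S \<and> (\<Sum>K\<in>D. Sup K - Inf K) < \<delta> \<longrightarrow>
        (\<Sum>K\<in>D. \<bar>(g (Sup K) + h (Sup K)) - (g (Inf K) + h (Inf K))\<bar>) < \<epsilon>"
  proof (intro exI[of _ "min d1 d2"] conjI allI impI)
    show "min d1 d2 > 0" using d1 d2 by simp
    fix D :: "real set set" assume D: "D division_of \<Union>D \<and> \<Union>D \<subseteq> S \<and> (\<Sum>K\<in>D. Sup K - Inf K) < min d1 d2"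
    have "(\<Sum>K\<in>D. \<bar>(g (Sup K) + h (Sup K)) - (g (Inf K) + h (Inf K))\<bar>)
      \<le> (\<Sum>K\<in>D. \<bar>g (Sup K) - g (Inf K)\<bar> + \<bar>h (Sup K) - h (Inf K)\<bar>)"
      by (intro sum_mono) linarith
    also have "\<dots> < \<epsilon>"
      using d1(2)[of D] d2(2)[of D] D by (simp add: sum.distrib)
    finally show "(\<Sum>K\<in>D. \<bar>(g (Sup K) + h (Sup K)) - (g (Inf K) + h (Inf K))\<bar>) < \<epsilon>" .
  qed
qed

lemma abs_continuous_on_uminus:
  assumes "abs_continuous_on S g"
  shows "abs_continuous_on S (\<lambda>t. - g t)"
  using assms unfolding abs_continuous_on_def by (simp add: abs_minus_commute)

lemma abs_continuous_on_diff:
  assumes "abs_continuous_on S g" "abs_continuous_on S h"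
  shows "abs_continuous_on S (\<lambda>t. g t - h t)"
  using abs_continuous_on_add[OF assms(1) abs_continuous_on_uminus[OF assms(2)]] by simp

lemma abs_continuous_on_lipschitz:
  fixes g :: "real \<Rightarrow> real"
  assumes "\<And>s t. s \<in> S \<Longrightarrow> t \<in> S \<Longrightarrow> \<bar>g t - g s\<bar> \<le> M * \<bar>t - s\<bar>"
  shows "abs_continuous_on S g"
  unfolding abs_continuous_on_def
proof (intro allI impI)
  fix \<epsilon> :: real assume "\<epsilon> > 0"
  show "\<exists>\<delta>>0. \<forall>D. D division_of \<Union>D \<and> \<Union>D \<subseteq> S \<and> (\<Sum>K\<in>D. Sup K - Inf K) < \<delta> \<longrightarrow>
        (\<Sum>K\<in>D. \<bar>g (Sup K) - g (Inf K)\<bar>) < \<epsilon>"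
  proof (intro exI[of _ "\<epsilon> / (\<bar>M\<bar> + 1)"] conjI allI impI)
    \<comment> \<open>The \<open>+ 1\<close> keeps the denominator positive also for
      \<open>M = 0\<close>, and the absolute value admits a negative \<open>M\<close>.\<close>
    show "\<epsilon> / (\<bar>M\<bar> + 1) > 0" using \<open>\<epsilon> > 0\<close> by (simp add: field_simps)
    fix D :: "real set set"
    assume D: "D division_of \<Union>D \<and> \<Union>D \<subseteq> S \<and> (\<Sum>K\<in>D. Sup K - Inf K) < \<epsilon> / (\<bar>M\<bar> + 1)"
    have *: "\<bar>g (Sup K) - g (Inf K)\<bar> \<le> (\<bar>M\<bar> + 1) * (Sup K - Inf K)" if "K \<in> D" for K
    proof -
      obtain l r where K: "K = {l..r}" "l \<le> r" "Sup K = r" "Inf K = l"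
        using division_real_interval[OF conjunct1[OF D] \<open>K \<in> D\<close>] by blast
      moreover have "K \<subseteq> S" using D that by blast
      ultimately have "l \<in> S" "r \<in> S" by auto
      then have "\<bar>g r - g l\<bar> \<le> M * \<bar>r - l\<bar>" using assms by blast
      also have "\<dots> \<le> (\<bar>M\<bar> + 1) * (r - l)" using K(2) by (intro mult_mono) auto
      finally show ?thesis using K by simp
    qed
    have "(\<Sum>K\<in>D. \<bar>g (Sup K) - g (Inf K)\<bar>) \<le> (\<bar>M\<bar> + 1) * (\<Sum>K\<in>D. Sup K - Inf K)"
      unfolding sum_distrib_left by (intro sum_mono *)
    also have "\<dots> < \<epsilon>" using D by (simp add: field_simps)
    finally show "(\<Sum>K\<in>D. \<bar>g (Sup K) - g (Inf K)\<bar>) < \<epsilon>" .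
  qed
qed

text \<open>Compactness bounds \<open>g'\<close>, and the mean value inequality then makes
  \<open>g\<close> Lipschitz on the interval.\<close>

lemma abs_continuous_on_C1:
  fixes g g' :: "real \<Rightarrow> real"
  assumes "\<And>t. t \<in> {c..d} \<Longrightarrow> (g has_real_derivative g' t) (at t within {c..d})"
    and "continuous_on {c..d} g'"
  shows "abs_continuous_on {c..d} g"
proof -
  have "bounded (g' ` {c..d})"
    using assms(2) by (simp add: compact_continuous_image compact_imp_bounded)
  then obtain M where M: "\<And>t. t \<in> {c..d} \<Longrightarrow> norm (g' t) \<le> M"
    unfolding bounded_iff by blast
  show ?thesis
    by (rule abs_continuous_on_lipschitz[of _ _ M])
      (use field_differentiable_bound[of "{c..d}" g g' M] assms(1) M in auto)
qed

text \<open>A fine tagged division splits into intervals tagged outside \<^term>\<open>N\<close>, where the increments are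
  small because the derivative vanishes, and intervals tagged in \<^term>\<open>N\<close>, whose total length is
  small, so that absolute continuity applies.\<close>

lemma abs_continuous_on_derivative_zero_imp_eq:
  fixes h :: "real \<Rightarrow> real"
  assumes ac: "abs_continuous_on {c..d} h" and "c \<le> d" and N: "negligible N"
    and deriv: "\<And>t. t \<in> {c..d} - N \<Longrightarrow> (h has_real_derivative 0) (at t within {c..d})"
  shows "h d = h c"
proof -
  have "\<bar>h d - h c\<bar> \<le> e" if "e > 0" for e :: real
  proof -
    \<comment> \<open>Cells tagged outside \<open>N\<close> will contribute at most
      \<open>\<epsilon> * (d - c)\<close> and the others at most \<open>\<epsilon>\<close>. The
      \<open>+ 1\<close> makes both bounds add up to \<open>e\<close> and avoids a zero denominator
      when \<open>c = d\<close>.\<close>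
    define \<epsilon> where "\<epsilon> = e / (d - c + 1)"
    have \<epsilon>: "\<epsilon> > 0" "\<epsilon> * (d - c) + \<epsilon> = e"
    proof -
      have "\<epsilon> * (d - c + 1) = e" using \<open>c \<le> d\<close> by (simp add: \<epsilon>_def)
      then show "\<epsilon> * (d - c) + \<epsilon> = e" by (simp add: algebra_simps)
    qed (use \<open>e > 0\<close> \<open>c \<le> d\<close> in \<open>simp add: \<epsilon>_def\<close>)
    obtain \<delta> where "\<delta> > 0" and \<delta>: "\<And>D. D division_of \<Union>D \<and> \<Union>D \<subseteq> {c..d} \<and> (\<Sum>K\<in>D. Sup K - Inf K) < \<delta> \<Longrightarrow>
        (\<Sum>K\<in>D. \<bar>h (Sup K) - h (Inf K)\<bar>) < \<epsilon>"
      using ac \<open>\<epsilon> > 0\<close> unfolding abs_continuous_on_def by meson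
    \<comment> \<open>Outer regularity bounds only the measure of \<open>U - N\<close>; as
      \<open>N\<close> is null, the bound passes to \<open>U\<close>.\<close>
    obtain U where U: "open U" "N \<subseteq> U" "(U - N) \<in> lmeasurable" "emeasure lebesgue (U - N) < ennreal \<delta>"
      using sets_lebesgue_outer_open[OF negligible_imp_sets[OF N] \<open>\<delta> > 0\<close>] by metis
    have U_lm: "U \<in> lmeasurable" and "measure lebesgue U = measure lebesgue (U - N)"
    proof -
      have "U = (U - N) \<union> N" using U by auto
      then show "U \<in> lmeasurable"
        by (metis N U(3) fmeasurable.Un negligible_imp_measurable)
      show "measure lebesgue U = measure lebesgue (U - N)"
        by (rule measure_negligible_symdiff[OF U(3)]) (use U N in \<open>auto intro: negligible_subset\<close>)
    qed
    then have mU: "measure lebesgue U < \<delta>"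
      using U(3,4) \<open>\<delta> > 0\<close> by (metis emeasure_eq_measure2 ennreal_less_iff measure_nonneg)
    have "\<exists>\<eta>>0. t \<in> {c..d} - N \<longrightarrow> (\<forall>s\<in>{c..d}. \<bar>s - t\<bar> < \<eta> \<longrightarrow> \<bar>h s - h t\<bar> \<le> \<epsilon> * \<bar>s - t\<bar>)" for t
    proof (cases "t \<in> {c..d} - N")
      case True
      then have "(h has_derivative (\<lambda>_. 0)) (at t within {c..d})"
        using deriv[OF True] by (simp add: has_field_derivative_def lambda_zero)
      then show ?thesis
        using \<open>\<epsilon> > 0\<close> unfolding has_derivative_within_alt by (auto dest!: spec[of _ \<epsilon>])
    qed (auto intro: exI[of _ 1])
    then obtain \<eta> where \<eta>: "\<And>t. \<eta> t > 0"
        "\<And>t s. t \<in> {c..d} - N \<Longrightarrow> s \<in> {c..d} \<Longrightarrow> \<bar>s - t\<bar> < \<eta> t \<Longrightarrow> \<bar>h s - h t\<bar> \<le> \<epsilon> * \<bar>s - t\<bar>"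
      by metis
    \<comment> \<open>A cell tagged in \<open>N\<close> is confined to \<open>U\<close>, any other
      cell to a ball on which the increments of \<open>h\<close> from its tag are small.\<close>
    define \<gamma> where "\<gamma> = (\<lambda>t. if t \<in> N then U else ball t (\<eta> t))"
    have "gauge \<gamma>"
      using U \<eta>(1) by (auto simp: gauge_def \<gamma>_def)
    then obtain p where p: "p tagged_division_of {c..d}" "\<gamma> fine p"
      by (rule fine_division_exists_real)
    define inc where "inc = (\<lambda>K::real set. \<bar>h (Sup K) - h (Inf K)\<bar>)"
    define p1 p2 where "p1 = {q \<in> p. fst q \<notin> N}" and "p2 = {q \<in> p. fst q \<in> N}"
    have fin: "finite p" using p(1) by auto
    then have p12: "finite p1" "finite p2" "p1 \<inter> p2 = {}" "p = p1 \<union> p2"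
      by (auto simp: p1_def p2_def)
    have len: "(\<Sum>(x,K)\<in>p. Sup K - Inf K) = d - c"
      using additive_tagged_division_1[OF \<open>c \<le> d\<close> p(1), of "\<lambda>x. x"] by simp
    have pK: "\<exists>l r. K = {l..r} \<and> l \<le> r \<and> Sup K = r \<and> Inf K = l \<and> x \<in> K \<and> K \<subseteq> {c..d} \<and> K \<subseteq> \<gamma> x"
      if "(x, K) \<in> p" for x K
      using tagged_division_ofD(2,3,4)[OF p(1) that] fineD[OF p(2) that] by auto
    have sum1: "(\<Sum>(x,K)\<in>p1. inc K) \<le> \<epsilon> * (d - c)"
    proof -
      have "(\<Sum>(x,K)\<in>p1. inc K) \<le> (\<Sum>(x,K)\<in>p1. \<epsilon> * (Sup K - Inf K))"
      proof (rule sum_mono, clarify)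
        fix x K assume "(x, K) \<in> p1"
        then have xK: "(x, K) \<in> p" "x \<notin> N" by (auto simp: p1_def)
        obtain l r where K: "K = {l..r}" "l \<le> r" "Sup K = r" "Inf K = l" "x \<in> K" "K \<subseteq> {c..d}" "K \<subseteq> \<gamma> x"
          using pK[OF xK(1)] by blast
        have "l \<in> K" "r \<in> K" "K \<subseteq> ball x (\<eta> x)"
          using K xK by (auto simp: \<gamma>_def)
        then have "l \<in> ball x (\<eta> x)" "r \<in> ball x (\<eta> x)" "x \<in> {c..d} - N" "l \<in> {c..d}" "r \<in> {c..d}"
          using K(5,6) xK by blast+
        then have "\<bar>h l - h x\<bar> \<le> \<epsilon> * \<bar>l - x\<bar>" "\<bar>h r - h x\<bar> \<le> \<epsilon> * \<bar>r - x\<bar>"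
          by (auto intro!: \<eta>(2) simp: dist_real_def)
        moreover have "\<bar>l - x\<bar> = x - l" "\<bar>r - x\<bar> = r - x" using K by auto
        ultimately have "\<bar>h r - h l\<bar> \<le> \<epsilon> * (r - l)" by (simp add: algebra_simps)
        then show "inc K \<le> \<epsilon> * (Sup K - Inf K)"
          using K by (simp add: inc_def)
      qed
      also have "\<dots> \<le> (\<Sum>(x,K)\<in>p. \<epsilon> * (Sup K - Inf K))"
        by (intro sum_mono2[OF fin]) (use pK \<epsilon> in \<open>fastforce simp: p1_def\<close>)+
      also have "\<dots> = \<epsilon> * (d - c)"
        unfolding len[symmetric] sum_distrib_left by (simp add: case_prod_unfold)
      finally show ?thesis .
    qed
    have sum2: "(\<Sum>(x,K)\<in>p2. inc K) \<le> \<epsilon>"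
    proof -
      have "p2 tagged_partial_division_of {c..d}"
        using p(1) tagged_partial_division_subset[of p "{c..d}" p2]
        by (auto simp: p2_def tagged_division_of_def)
      note td = tagged_partial_division_of_Union_self[OF this]
        and dv = partial_division_of_tagged_division[OF this]
      have ne: "K \<noteq> {}" if "(x, K) \<in> p2" for x K
        using pK[of x K] that by (auto simp: p2_def)
      \<comment> \<open>Different tags may share a degenerate cell, so replacing tagged pairs by
        cells requires a summand that vanishes on every box with empty interior. This includes the
        empty box, where \<open>Sup\<close> and \<open>Inf\<close> carry no information; hence the
        case distinction.\<close>
      then have "(\<Sum>(x,K)\<in>p2. inc K) = (\<Sum>(x,K)\<in>p2. if K = {} then 0 else inc K)"
        by (intro sum.cong) auto
      also have "\<dots> = (\<Sum>K\<in>snd ` p2. if K = {} then 0 else inc K)"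
        by (rule sum.over_tagged_division_lemma[OF td]) (auto simp: inc_def box_eq_empty not_less order_le_less)
      also have "\<dots> = sum inc (snd ` p2)"
        by (intro sum.cong) (use ne in auto)
      also have "\<dots> \<le> \<epsilon>"
        unfolding inc_def
      proof (rule less_imp_le, rule \<delta>, intro conjI)
        show "snd ` p2 division_of \<Union> (snd ` p2)" by (rule dv)
        show "\<Union> (snd ` p2) \<subseteq> {c..d}"
          using pK by (fastforce simp: p2_def)
        have "\<Union> (snd ` p2) \<subseteq> U"
          using pK by (fastforce simp: p2_def \<gamma>_def split: if_splits)
        then have "measure lebesgue (\<Union> (snd ` p2)) \<le> measure lebesgue U"
          by (intro measure_mono_fmeasurable U_lm) (use lmeasurable_division[OF dv] in auto)
        then show "(\<Sum>K\<in>snd ` p2. Sup K - Inf K) < \<delta>"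
          using mU by (simp add: sum_length_division[OF dv])
      qed
      finally show ?thesis .
    qed
    have "\<bar>h d - h c\<bar> = \<bar>\<Sum>(x,K)\<in>p. h (Sup K) - h (Inf K)\<bar>"
      by (simp add: additive_tagged_division_1[OF \<open>c \<le> d\<close> p(1)])
    also have "\<dots> \<le> (\<Sum>(x,K)\<in>p. inc K)"
      by (rule order_trans[OF sum_abs]) (simp add: inc_def case_prod_unfold)
    also have "\<dots> = (\<Sum>(x,K)\<in>p1. inc K) + (\<Sum>(x,K)\<in>p2. inc K)"
      using p12 by (simp add: sum.union_disjoint)
    also have "\<dots> \<le> e" using sum1 sum2 \<epsilon> by linarith
    finally show ?thesis .
  qed
  then have "\<bar>h d - h c\<bar> \<le> 0" by (rule field_le_epsilon[of _ 0, simplified])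
  then show ?thesis by simp
qed

text \<open>Truncation at height \<open>n\<close>: \<open>\<bar>f t\<bar>\<close> is at most
  \<open>n\<close> plus the excess \<open>g n t\<close>, and the integral of the excess tends to 0
  by dominated convergence. The increments over \<open>D\<close> are thus bounded by
  \<open>n\<close> times the total length plus a small integral.\<close>

lemma abs_continuous_on_indefinite_integral:
  fixes f F :: "real \<Rightarrow> real"
  assumes f: "f absolutely_integrable_on {c..d}"
    and F: "\<And>l r. c \<le> l \<Longrightarrow> l \<le> r \<Longrightarrow> r \<le> d \<Longrightarrow> F r - F l = integral {l..r} f"
  shows "abs_continuous_on {c..d} F"
  unfolding abs_continuous_on_def
proof (intro allI impI)
  fix \<epsilon> :: real assume "\<epsilon> > 0"
  define g where "g = (\<lambda>n t. max (\<bar>f t\<bar> - real n) 0)"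
  have af: "(\<lambda>t. \<bar>f t\<bar>) absolutely_integrable_on {c..d}"
    using absolutely_integrable_norm[OF f] by (simp add: o_def)
  have ag: "g n absolutely_integrable_on {c..d}" for n
    unfolding g_def
    by (intro absolutely_integrable_max_1 set_integral_diff(1) af) (auto simp: absolutely_integrable_on_def)
  have "(\<lambda>n. integral {c..d} (g n)) \<longlonglongrightarrow> integral {c..d} (\<lambda>_. 0)"
  proof (rule dominated_convergence(2))
    show "g n integrable_on {c..d}" for n using ag set_lebesgue_integral_eq_integral(1) by blast
    show "(\<lambda>t. \<bar>f t\<bar>) integrable_on {c..d}" using af set_lebesgue_integral_eq_integral(1) by blast
    show "norm (g n t) \<le> \<bar>f t\<bar>" for n t by (auto simp: g_def)
    show "(\<lambda>n. g n t) \<longlonglongrightarrow> 0" for t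
    proof (rule tendsto_eventually)
      obtain m where "\<bar>f t\<bar> \<le> real m" using real_arch_simple by blast
      then show "\<forall>\<^sub>F n in sequentially. g n t = 0"
        unfolding eventually_sequentially by (intro exI[of _ m]) (auto simp: g_def max_def)
    qed
  qed
  then have "\<forall>\<^sub>F n in sequentially. integral {c..d} (g n) < \<epsilon>/2"
    by (rule order_tendstoD(2)) (use \<open>\<epsilon> > 0\<close> in simp)
  then obtain n where n: "integral {c..d} (g n) < \<epsilon>/2"
    by (auto simp: eventually_sequentially)
  show "\<exists>\<delta>>0. \<forall>D. D division_of \<Union>D \<and> \<Union>D \<subseteq> {c..d} \<and> (\<Sum>K\<in>D. Sup K - Inf K) < \<delta> \<longrightarrow>
        (\<Sum>K\<in>D. \<bar>F (Sup K) - F (Inf K)\<bar>) < \<epsilon>"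
  proof (intro exI[of _ "\<epsilon> / (2 * (real n + 1))"] conjI allI impI)
    \<comment> \<open>A total length below this value contributes at most
      \<open>\<epsilon> / 2\<close>, and the excess less than \<open>\<epsilon> / 2\<close>; the
      \<open>+ 1\<close> covers \<open>n = 0\<close>.\<close>
    show "\<epsilon> / (2 * (real n + 1)) > 0" using \<open>\<epsilon> > 0\<close> by (simp add: field_simps)
    fix D :: "real set set"
    assume D: "D division_of \<Union>D \<and> \<Union>D \<subseteq> {c..d} \<and> (\<Sum>K\<in>D. Sup K - Inf K) < \<epsilon> / (2 * (real n + 1))"
    have *: "\<bar>F (Sup K) - F (Inf K)\<bar> \<le> real n * (Sup K - Inf K) + integral K (g n)" if "K \<in> D" for K
    proof -
      obtain l r where K: "K = {l..r}" "l \<le> r" "Sup K = r" "Inf K = l"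
        using division_real_interval[OF conjunct1[OF D] \<open>K \<in> D\<close>] by blast
      moreover have "K \<subseteq> {c..d}" using D that by blast
      ultimately have lr: "c \<le> l" "r \<le> d" by auto
      then have sub: "{l..r} \<subseteq> {c..d}" by auto
      have ig: "g n integrable_on {l..r}"
        using integrable_on_subinterval[OF _ sub] ag set_lebesgue_integral_eq_integral(1) by blast
      have "\<bar>F r - F l\<bar> = norm (integral {l..r} f)" using F[OF lr(1) K(2) lr(2)] by simp
      also have "\<dots> \<le> integral {l..r} (\<lambda>t. real n + g n t)"
      proof (rule integral_norm_bound_integral)
        show "f integrable_on {l..r}"
          using integrable_on_subinterval[OF _ sub] f set_lebesgue_integral_eq_integral(1) by blast
        show "(\<lambda>t. real n + g n t) integrable_on {l..r}" by (intro integrable_add ig) auto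
      qed (auto simp: g_def)
      also have "\<dots> = real n * (r - l) + integral {l..r} (g n)"
        using K(2) by (subst integral_add) (auto intro: ig)
      finally show ?thesis using K by simp
    qed
    have "(\<Sum>K\<in>D. \<bar>F (Sup K) - F (Inf K)\<bar>) \<le> real n * (\<Sum>K\<in>D. Sup K - Inf K) + (\<Sum>K\<in>D. integral K (g n))"
      unfolding sum_distrib_left sum.distrib[symmetric] by (intro sum_mono *)
    also have "(\<Sum>K\<in>D. integral K (g n)) \<le> integral {c..d} (g n)"
    proof -
      have hi: "(g n has_integral (\<Sum>K\<in>D. integral K (g n))) (\<Union>D)"
        using has_integral_combine_division_topdown[of "g n" "{c..d}" D "\<Union>D"] D ag set_lebesgue_integral_eq_integral(1) by blast
      show ?thesis
        by (rule has_integral_subset_le[OF _ hi integrable_integral])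
          (use D ag set_lebesgue_integral_eq_integral(1) in \<open>auto simp: g_def\<close>)
    qed
    also have "real n * (\<Sum>K\<in>D. Sup K - Inf K) \<le> real n * (\<epsilon> / (2 * (real n + 1)))"
      using D by (intro mult_left_mono) auto
    also have "\<dots> \<le> \<epsilon> / 2" using \<open>\<epsilon> > 0\<close> by (simp add: field_simps)
    finally show "(\<Sum>K\<in>D. \<bar>F (Sup K) - F (Inf K)\<bar>) < \<epsilon>" using n by simp
  qed
qed

subsection \<open>Differentiation of the integral and scalar linear equations\<close>

text \<open>The two one-sided difference quotients are controlled by the Henstock differentiability of
  \<^term>\<open>f\<close> and of its reflection.\<close>

lemma integral_has_real_derivative_AE:
  fixes f :: "real \<Rightarrow> real"
  assumes f: "\<And>a b. f integrable_on {a..b}"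
  shows "\<exists>N. negligible N \<and>
    (\<forall>x c. x \<notin> N \<longrightarrow> c < x \<longrightarrow> ((\<lambda>t. integral {c..t} f) has_real_derivative f x) (at x))"
proof -
  have one: "\<And>a b. f integrable_on cbox a b"
    and refl: "\<And>a b. (\<lambda>x. f (- x)) integrable_on cbox a b"
    using f by (auto simp: cbox_interval, metis minus_minus Henstock_Kurzweil_Integration.integrable_reflect_real)
  obtain N1 where N1: "negligible N1"
      "\<And>x e. x \<notin> N1 \<Longrightarrow> 0 < e \<Longrightarrow> \<exists>d>0. \<forall>h. 0 < h \<and> h < d \<longrightarrow> norm (integral {x..x + h} f / h - f x) < e"
    using integrable_ccontinuous_explicit[OF one] by (simp add: cbox_interval divide_inverse mult.commute) metis
  obtain N2 where N2: "negligible N2"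
      "\<And>x e. x \<notin> N2 \<Longrightarrow> 0 < e \<Longrightarrow> \<exists>d>0. \<forall>h. 0 < h \<and> h < d \<longrightarrow>
          norm (integral {x..x + h} (\<lambda>x. f (- x)) / h - f (- x)) < e"
    using integrable_ccontinuous_explicit[OF refl] by (simp add: cbox_interval divide_inverse mult.commute) metis
  \<comment> \<open>The reflected function is differentiated at \<open>- x\<close>, so its
    exceptional set has to be reflected back.\<close>
  define N where "N = N1 \<union> uminus ` N2"
  have "negligible N"
    unfolding N_def
    by (intro negligible_Un N1(1) negligible_differentiable_image_negligible N2(1) derivative_intros) simp
  moreover have "((\<lambda>t. integral {c..t} f) has_real_derivative f x) (at x)" if "x \<notin> N" "c < x" for x c
    unfolding DERIV_def tendsto_iff
  proof (intro allI impI)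
    fix e :: real assume "e > 0"
    have x: "x \<notin> N1" "- x \<notin> N2" using that(1) by (auto simp: N_def image_iff)
    obtain d1 where d1: "d1 > 0" "\<And>h. 0 < h \<Longrightarrow> h < d1 \<Longrightarrow> norm (integral {x..x + h} f / h - f x) < e"
      using N1(2)[OF x(1) \<open>e > 0\<close>] by blast
    obtain d2 where d2: "d2 > 0" "\<And>h. 0 < h \<Longrightarrow> h < d2 \<Longrightarrow>
        norm (integral {-x..-x + h} (\<lambda>x. f (- x)) / h - f x) < e"
      using N2(2)[OF x(2) \<open>e > 0\<close>] by auto
    have comb: "integral {c..s} f - integral {c..t} f = integral {t..s} f" if "c \<le> t" "t \<le> s" for s t
      using Henstock_Kurzweil_Integration.integral_combine[OF that f] by simp
    \<comment> \<open>The bound \<open>x - c\<close> keeps \<open>x + h\<close> to the right of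
      \<open>c\<close>, so that \<open>comb\<close> also applies to negative \<open>h\<close>, where
      the reflected integral takes over.\<close>
    have "dist ((integral {c..x + h} f - integral {c..x} f) / h) (f x) < e"
      if h: "h \<noteq> 0" "\<bar>h\<bar> < min (min d1 d2) (x - c)" for h
    proof (cases "h > 0")
      case True
      then show ?thesis
        using d1(2)[of h] h comb[of x "x + h"] \<open>c < x\<close> by (simp add: dist_real_def)
    next
      case False
      have "integral {-x..-x + (-h)} (\<lambda>x. f (- x)) = integral {x + h..x} f"
        using Henstock_Kurzweil_Integration.integral_reflect_real[of x "x + h" f] by (simp add: add.commute)
      then have "(integral {c..x + h} f - integral {c..x} f) / h = integral {-x..-x + (-h)} (\<lambda>x. f (- x)) / (-h)"
        using comb[of "x + h" x] h False by (simp add: field_simps)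
      then show ?thesis
        using d2(2)[of "-h"] h False by (simp add: dist_real_def)
    qed
    then show "\<forall>\<^sub>F h in at 0. dist ((integral {c..x + h} f - integral {c..x} f) / h) (f x) < e"
      unfolding eventually_at using d1(1) d2(1) \<open>c < x\<close>
      by (intro exI[of _ "min (min d1 d2) (x - c)"]) (simp add: dist_real_def)
  qed
  ultimately show ?thesis by blast
qed

section \<open>Scalar linear equations on a half-line\<close>

lemma has_vector_derivative_integral_ge0:
  fixes g :: "real \<Rightarrow> 'a::banach"
  assumes "continuous_on {c..} g" "t \<ge> c"
  shows "((\<lambda>u. integral {c..u} g) has_vector_derivative g t) (at t within {c..})"
proof -
  have "((\<lambda>u. integral {c..u} g) has_vector_derivative g t) (at t within {c..t + 1})"
    using assms by (intro integral_has_vector_derivative continuous_on_subset[OF assms(1)]) auto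
  moreover have "at t within {c..t + 1} = at t within {c..}"
    by (rule at_within_nhd[of _ "{..<t + 1}"]) auto
  ultimately show ?thesis by simp
qed

text \<open>Variation of constants. The type is general because the equation for \<open>lag\<close>
  is real, whereas the factors of the second-order operator may be complex.\<close>

lemma linear_ode_exists:
  fixes g :: "real \<Rightarrow> 'a::{real_normed_field, banach}"
  assumes "continuous_on {0..} g"
  obtains z where "z 0 = z0" "\<And>t. t \<ge> 0 \<Longrightarrow> (z has_vector_derivative g t - c * z t) (at t within {0..})"
proof -
  define z where "z = (\<lambda>t. exp (t *\<^sub>R (- c)) * (z0 + integral {0..t} (\<lambda>s. exp (s *\<^sub>R c) * g s)))"
  have "(z has_vector_derivative g t - c * z t) (at t within {0..})" if "t \<ge> 0" for t
  proof -
    have "((\<lambda>u. integral {0..u} (\<lambda>s. exp (s *\<^sub>R c) * g s)) has_vector_derivative exp (t *\<^sub>R c) * g t)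
        (at t within {0..})"
      by (rule has_vector_derivative_integral_ge0) (intro continuous_intros assms, fact)
    then have "(z has_vector_derivative
        exp (t *\<^sub>R (- c)) * (exp (t *\<^sub>R c) * g t) +
        exp (t *\<^sub>R (- c)) * (- c) * (z0 + integral {0..t} (\<lambda>s. exp (s *\<^sub>R c) * g s))) (at t within {0..})"
      unfolding z_def
      by (intro derivative_eq_intros exp_scaleR_has_vector_derivative_right has_vector_derivative_mult) auto
    moreover have "exp (t *\<^sub>R (- c)) * (exp (t *\<^sub>R c) * g t) = g t"
      by (simp add: exp_minus)
    moreover have "exp (t *\<^sub>R (- c)) * (- c) * (z0 + integral {0..t} (\<lambda>s. exp (s *\<^sub>R c) * g s)) = - c * z t"
      by (simp add: z_def mult.commute mult.left_commute)
    ultimately have "(z has_vector_derivative g t + - c * z t) (at t within {0..})"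
      by (simp only:)
    then show ?thesis
      by simp
  qed
  moreover have "z 0 = z0" by (simp add: z_def)
  ultimately show ?thesis by (intro that)
qed

text \<open>The integrating factor removes \<open>c\<close>: \<open>\<phi>\<close> has derivative
  \<open>exp (t *\<^sub>R c) * g t\<close>. Once \<open>norm (g t)\<close> is below
  \<open>\<rho> * e / 2\<close>, integration cancels the factor \<open>\<rho>\<close> and
  \<open>\<phi>\<close> grows by at most \<open>e / 2 * exp (\<rho> * t)\<close>. Division by
  \<open>exp (\<rho> * t)\<close> leaves \<open>e / 2\<close> plus a decaying term from the starting
  value.\<close>

lemma linear_ode_tendsto_0:
  fixes z g :: "real \<Rightarrow> 'a::{real_normed_field, banach}"
  assumes deriv: "\<And>t. t \<ge> T0 \<Longrightarrow> (z has_vector_derivative g t - c * z t) (at t within {T0..})"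
    and g: "(g \<longlongrightarrow> 0) at_top"
    and \<rho>: "\<And>t. norm (exp (t *\<^sub>R c)) = exp (\<rho> * t)" "\<rho> > 0"
  shows "(z \<longlongrightarrow> 0) at_top"
  unfolding tendsto_iff
proof (intro allI impI)
  fix e :: real assume "e > 0"
  have "\<forall>\<^sub>F t in at_top. norm (g t) < \<rho> * e / 2"
    using tendstoD[OF g, of "\<rho> * e / 2"] \<open>e > 0\<close> \<rho>(2) by simp
  then obtain T1 where T1: "\<And>t. t \<ge> T1 \<Longrightarrow> norm (g t) < \<rho> * e / 2"
    by (auto simp: eventually_at_top_linorder)
  define T where "T = max T0 T1"
  define \<phi> where "\<phi> = (\<lambda>t. exp (t *\<^sub>R c) * z t)"
  have d\<phi>: "(\<phi> has_vector_derivative exp (t *\<^sub>R c) * g t) (at t within {T0..})" if "t \<ge> T0" for t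
  proof -
    have "(\<phi> has_vector_derivative exp (t *\<^sub>R c) * (g t - c * z t) + exp (t *\<^sub>R c) * c * z t) (at t within {T0..})"
      unfolding \<phi>_def by (intro has_vector_derivative_mult exp_scaleR_has_vector_derivative_right deriv that)
    then show ?thesis by (simp add: algebra_simps)
  qed
  have bound: "norm (\<phi> t - \<phi> T) \<le> e / 2 * exp (\<rho> * t) - e / 2 * exp (\<rho> * T)" if "t > T" for t
  proof (rule differentiable_bound_general[OF that])
    show "continuous_on {T..t} \<phi>"
      by (rule continuous_on_subset[of "{T0..}"], rule continuous_on_vector_derivative[OF d\<phi>])
        (auto simp: T_def)
    show "continuous_on {T..t} (\<lambda>t. e / 2 * exp (\<rho> * t))" by (intro continuous_intros)
    fix s assume s: "T < s" "s < t"
    then have "at s within {T0..} = at s"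
      by (intro at_within_interior) (auto simp: T_def)
    then show "(\<phi> has_vector_derivative exp (s *\<^sub>R c) * g s) (at s)"
      using d\<phi>[of s] s by (simp add: T_def)
    show "((\<lambda>t. e / 2 * exp (\<rho> * t)) has_vector_derivative e / 2 * (exp (\<rho> * s) * \<rho>)) (at s)"
      unfolding has_real_derivative_iff_has_vector_derivative[symmetric]
      by (auto intro!: derivative_eq_intros)
    show "norm (exp (s *\<^sub>R c) * g s) \<le> e / 2 * (exp (\<rho> * s) * \<rho>)"
      using T1[of s] s by (simp add: T_def norm_mult \<rho> field_simps)
  qed
  have "((\<lambda>t. norm (\<phi> T) * exp (- (\<rho> * t))) \<longlongrightarrow> 0) at_top"
    using \<rho>(2) by (auto intro!: tendsto_mult_right_zero filterlim_compose[OF exp_at_bot] filterlim_tendsto_pos_mult_at_top[OF tendsto_const] filterlim_ident simp: filterlim_uminus_at_bot)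
  then have "\<forall>\<^sub>F t in at_top. norm (\<phi> T) * exp (- (\<rho> * t)) < e / 2"
    using \<open>e > 0\<close> by (intro order_tendstoD(2)) auto
  then show "\<forall>\<^sub>F t in at_top. dist (z t) 0 < e"
    using eventually_gt_at_top[of T]
  proof eventually_elim
    case (elim t)
    have "exp (\<rho> * t) * norm (z t) = norm (\<phi> t)"
      by (simp add: \<phi>_def norm_mult \<rho>)
    also have "\<dots> \<le> norm (\<phi> T) + norm (\<phi> t - \<phi> T)"
      by (metis norm_triangle_sub)
    also have "\<dots> \<le> norm (\<phi> T) + e / 2 * exp (\<rho> * t)"
      using bound[OF elim(2)] \<open>e > 0\<close> by (smt (verit) exp_gt_zero mult_pos_pos half_gt_zero)
    also have "norm (\<phi> T) < e / 2 * exp (\<rho> * t)"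
      using elim(1) by (simp add: exp_minus field_simps)
    finally show ?case by simp
  qed
qed

lemma linear_ode_real_tendsto_0:
  fixes z g :: "real \<Rightarrow> real"
  assumes "\<And>t. t \<ge> T0 \<Longrightarrow> (z has_real_derivative g t - z t) (at t within {T0..})"
    and "(g \<longlongrightarrow> 0) at_top"
  shows "(z \<longlongrightarrow> 0) at_top"
  by (rule linear_ode_tendsto_0[of T0 z g 1 1])
    (use assms in \<open>auto simp: has_real_derivative_iff_has_vector_derivative\<close>)

lemma linear_ode_complex_tendsto_0:
  fixes z g :: "real \<Rightarrow> complex"
  assumes "\<And>t. t \<ge> T0 \<Longrightarrow> (z has_vector_derivative g t - c * z t) (at t within {T0..})"
    and "(g \<longlongrightarrow> 0) at_top" "Re c > 0"
  shows "(z \<longlongrightarrow> 0) at_top"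
  by (rule linear_ode_tendsto_0[of T0 z g c "Re c"]) (use assms in \<open>auto simp: mult.commute\<close>)

text \<open>These are the negatives of the characteristic roots. A nonnegative discriminant has a
  square root smaller than \<open>a\<close> because \<open>b > 0\<close>; a negative one has a
  purely imaginary square root.\<close>

lemma quadratic_roots_positive_real_part:
  fixes a b :: real
  assumes "a > 0" "b > 0"
  obtains \<nu> \<mu> :: complex where "\<nu> + \<mu> = of_real a" "\<nu> * \<mu> = of_real b" "Re \<nu> > 0" "Re \<mu> > 0"
proof -
  define s where "s = csqrt (of_real (a\<^sup>2 - 4 * b))"
  have s2: "s * s = of_real (a\<^sup>2 - 4 * b)"
    by (simp add: s_def flip: power2_eq_square)
  have "\<bar>Re s\<bar> < a"
  proof (cases "a\<^sup>2 - 4 * b \<ge> 0")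
    case True
    then have "Re s = sqrt (a\<^sup>2 - 4 * b)" by (simp add: s_def flip: of_real_sqrt)
    also have "\<dots> < sqrt (a\<^sup>2)" using assms by (intro real_sqrt_less_mono) simp
    finally show ?thesis using True assms \<open>Re s = _\<close> by simp
  next
    case False
    then have "Re s = 0" by (simp add: s_def csqrt.simps cmod_eq_Re)
    then show ?thesis using assms by simp
  qed
  then show ?thesis
    by (intro that[of "(of_real a + s) / 2" "(of_real a - s) / 2"])
      (auto simp: s2 field_simps power2_eq_square)
qed

subsection \<open>The primitive of the forcing term\<close>

definition primitive :: "(real \<Rightarrow> real) \<Rightarrow> real \<Rightarrow> real" where
  "primitive f t = integral {0..t} f"

lemma primitive_0 [simp]: "primitive f 0 = 0"
  by (simp add: primitive_def)

lemma L1_loc_absolutely_integrable: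
  assumes "f \<in> L1_loc {0..}" "0 \<le> l"
  shows "f absolutely_integrable_on {l..r}"
  using assms unfolding L1_loc_def by (auto simp: compact_Icc)

lemma L1_loc_integrable:
  assumes "f \<in> L1_loc {0..}" "0 \<le> l"
  shows "f integrable_on {l..r}"
  using L1_loc_absolutely_integrable[OF assms] set_lebesgue_integral_eq_integral(1) by blast

lemma primitive_diff:
  assumes "f \<in> L1_loc {0..}" "0 \<le> l" "l \<le> r"
  shows "primitive f r - primitive f l = integral {l..r} f"
  using Henstock_Kurzweil_Integration.integral_combine[OF assms(2,3) L1_loc_integrable[OF assms(1)]]
  by (simp add: primitive_def)

lemma continuous_on_ge0_iff:
  "continuous_on {0..} (g :: real \<Rightarrow> 'a::topological_space) \<longleftrightarrow> (\<forall>u. continuous_on {0..u} g)"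
proof
  assume *: "\<forall>u. continuous_on {0..u} g"
  show "continuous_on {0..} g"
    unfolding continuous_on_eq_continuous_within
  proof
    fix t :: real assume "t \<in> {0..}"
    then have "at t within {0..t + 1} = at t within {0..}" "t \<in> {0..t + 1}"
      by (auto intro: at_within_nhd[of _ "{..<t + 1}"])
    then show "continuous (at t within {0..}) g"
      using * unfolding continuous_on_eq_continuous_within by metis
  qed
qed (auto intro: continuous_on_subset)

lemma continuous_on_primitive:
  assumes "f \<in> L1_loc {0..}"
  shows "continuous_on {0..} (primitive f)"
  unfolding continuous_on_ge0_iff primitive_def[abs_def]
  by (intro allI indefinite_integral_continuous_1 L1_loc_integrable assms) simp

lemma abs_continuous_on_primitive:
  assumes "f \<in> L1_loc {0..}" "0 \<le> c"
  shows "abs_continuous_on {c..d} (primitive f)"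
  by (rule abs_continuous_on_indefinite_integral[OF L1_loc_absolutely_integrable[OF assms]])
    (use assms in \<open>auto intro: primitive_diff\<close>)

lemma primitive_has_real_derivative_AE:
  assumes f: "f \<in> L1_loc {0..}"
  shows "\<exists>N. negligible N \<and> (\<forall>t. t \<notin> N \<longrightarrow> t \<ge> 0 \<longrightarrow> (primitive f has_real_derivative f t) (at t within {0..}))"
proof -
  \<comment> \<open>Extension by zero makes the function integrable on every compact interval, as
    the differentiation lemma demands.\<close>
  define f0 where "f0 = (\<lambda>t. if t \<in> {0..} then f t else 0)"
  have "f0 integrable_on {a..b}" for a b
  proof -
    have "{0..} \<inter> {a..b} = {max 0 a..b}" by auto
    then show ?thesis
      unfolding f0_def integrable_restrict_Int using L1_loc_integrable[OF f, of "max 0 a" b] by simp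
  qed
  then obtain N where N: "negligible N"
      "\<And>x c. x \<notin> N \<Longrightarrow> c < x \<Longrightarrow> ((\<lambda>t. integral {c..t} f0) has_real_derivative f0 x) (at x)"
    using integral_has_real_derivative_AE by metis
  \<comment> \<open>The point 0 joins the exceptional set because differentiation is available only
    strictly to the right of the lower limit of integration.\<close>
  have "(primitive f has_real_derivative f t) (at t within {0..})" if "t \<notin> insert 0 N" "t \<ge> 0" for t
  proof -
    have eq: "integral {0..u} f0 = primitive f u" for u
      unfolding primitive_def f0_def by (intro integral_cong) auto
    have "((\<lambda>t. integral {0..t} f0) has_real_derivative f0 t) (at t)"
      using N(2)[of t 0] that by simp
    then show ?thesis
      using that unfolding eq[abs_def] by (auto simp: f0_def intro: has_field_derivative_at_within)
  qed
  moreover have "negligible (insert 0 N)" using N(1) by simp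
  ultimately show ?thesis by blast
qed

text \<open>Exponential smoothing of the primitive; integration by parts identifies
  \<^term>\<open>primitive f t - lag f t\<close> with the function \<^term>\<open>y1 f t\<close>.\<close>

definition lag :: "(real \<Rightarrow> real) \<Rightarrow> real \<Rightarrow> real" where
  "lag f = (SOME k. k 0 = 0 \<and>
     (\<forall>t\<ge>0. (k has_real_derivative primitive f t - k t) (at t within {0..})))"

lemma
  assumes f: "f \<in> L1_loc {0..}"
  shows lag_0: "lag f 0 = 0"
    and lag_deriv: "t \<ge> 0 \<Longrightarrow> (lag f has_real_derivative primitive f t - lag f t) (at t within {0..})"
proof -
  obtain k where "k 0 = 0" "\<And>t. t \<ge> 0 \<Longrightarrow> (k has_vector_derivative primitive f t - 1 * k t) (at t within {0..})"
    using linear_ode_exists[OF continuous_on_primitive[OF f]] by metis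
  then have "\<exists>k. k 0 = 0 \<and> (\<forall>t\<ge>0. (k has_real_derivative primitive f t - k t) (at t within {0..}))"
    by (auto simp: has_real_derivative_iff_has_vector_derivative)
  from someI_ex[OF this] show "lag f 0 = 0"
    and "t \<ge> 0 \<Longrightarrow> (lag f has_real_derivative primitive f t - lag f t) (at t within {0..})"
    unfolding lag_def[symmetric] by auto
qed

text \<open>This makes derivatives relative to the half-line unique, including the one-sided
  derivative at 0.\<close>

lemma at_within_ge0_neq_bot [simp]: "t \<ge> 0 \<Longrightarrow> at t within {0::real..} \<noteq> bot"
  using islimpt_subset[of t "{t..t + 1}" "{0..}"] by (auto simp: trivial_limit_within islimpt_Icc)

lemma DERIV_zero_ge0_imp_eq:
  fixes g :: "real \<Rightarrow> real"
  assumes "\<And>t. t \<ge> 0 \<Longrightarrow> (g has_real_derivative 0) (at t within {0..})" "t \<ge> 0"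
  shows "g t = g 0"
  using has_field_derivative_zero_constant[of "{0..}" g] assms by (auto simp: convex_real_interval)

text \<open>Neither term need be differentiable at \<open>t\<close>, but their irregular parts
  cancel. Freezing the weight \<open>exp s\<close> at \<open>exp t\<close> costs at most the
  increment of \<open>exp\<close> times the increment of the primitive of
  \<open>\<bar>f\<bar>\<close>; the first is of order \<open>s - t\<close> and the second tends to 0
  by continuity.\<close>

lemma exp_weighted_integral_has_derivative:
  assumes f: "f \<in> L1_loc {0..}" and t: "t \<ge> 0"
  shows "((\<lambda>t. integral {0..t} (\<lambda>s. exp s * f s) - exp t * primitive f t)
    has_real_derivative - (exp t * primitive f t)) (at t within {0..})"
proof -
  define P where "P = (\<lambda>t. integral {0..t} (\<lambda>s. exp s * f s))"
  define \<Phi> where "\<Phi> = primitive (\<lambda>s. \<bar>f s\<bar>)"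
  define q where "q = (\<lambda>s. (exp s - exp t) / (s - t))"
  \<comment> \<open>\<open>R s\<close> is the error made by replacing the weight with the constant
    \<open>exp t\<close> between \<open>t\<close> and \<open>s\<close>.\<close>
  define R where "R = (\<lambda>s. (P s - P t) - exp t * (primitive f s - primitive f t))"
  have abs: "(\<lambda>s. \<bar>f s\<bar>) \<in> L1_loc {0..}"
    using f absolutely_integrable_norm[where f = f] by (auto simp: L1_loc_def o_def)
  have ei: "(\<lambda>s. exp s * f s) integrable_on {l..r}" if "l \<ge> 0" for l r
  proof -
    have "(\<lambda>s. exp s * f s) absolutely_integrable_on {l..r}"
      by (rule absolutely_integrable_bounded_measurable_product_real)
       (use L1_loc_absolutely_integrable[OF f that] in \<open>auto intro!: continuous_imp_measurable_on_sets_lebesgue continuous_intros compact_imp_bounded compact_continuous_image\<close>)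
    then show ?thesis using set_lebesgue_integral_eq_integral(1) by blast
  qed
  have Rle: "\<bar>integral {l..r} (\<lambda>s. (exp s - exp c) * f s)\<bar> \<le> \<bar>exp r - exp l\<bar> * \<bar>\<Phi> r - \<Phi> l\<bar>"
    if "0 \<le> l" "l \<le> r" "c \<in> {l..r}" for l r c
  proof -
    have "norm (integral {l..r} (\<lambda>s. (exp s - exp c) * f s)) \<le> integral {l..r} (\<lambda>s. (exp r - exp l) * \<bar>f s\<bar>)"
    proof (rule integral_norm_bound_integral)
      show "(\<lambda>s. (exp s - exp c) * f s) integrable_on {l..r}"
        unfolding left_diff_distrib using that by (intro integrable_diff ei integrable_on_mult_right L1_loc_integrable f) auto
      show "(\<lambda>s. (exp r - exp l) * \<bar>f s\<bar>) integrable_on {l..r}"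
        using that by (intro integrable_on_mult_right L1_loc_integrable abs) auto
      fix s assume "s \<in> {l..r}"
      then have "exp l \<le> exp s" "exp s \<le> exp r" "exp l \<le> exp c" "exp c \<le> exp r"
        using that by auto
      then have "\<bar>exp s - exp c\<bar> \<le> exp r - exp l" by linarith
      then show "norm ((exp s - exp c) * f s) \<le> (exp r - exp l) * \<bar>f s\<bar>"
        by (auto simp: abs_mult intro: mult_right_mono)
    qed
    also have "\<dots> = (exp r - exp l) * (\<Phi> r - \<Phi> l)"
      unfolding \<Phi>_def primitive_diff[OF abs that(1,2)] by simp
    also have "\<dots> \<le> \<bar>exp r - exp l\<bar> * \<bar>\<Phi> r - \<Phi> l\<bar>" by (simp flip: abs_mult)
    finally show ?thesis by simp
  qed
  have P_diff: "P r - P l = integral {l..r} (\<lambda>s. exp s * f s)" if "0 \<le> l" "l \<le> r" for l r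
    using Henstock_Kurzweil_Integration.integral_combine[OF that ei] by (simp add: P_def)
  have split: "integral {l..r} (\<lambda>s. (exp s - exp c) * f s) = (P r - P l) - exp c * (primitive f r - primitive f l)"
    if "0 \<le> l" "l \<le> r" for l r c
    unfolding left_diff_distrib P_diff[OF that] primitive_diff[OF f that] using that
    by (subst integral_diff) (auto intro: ei integrable_on_mult_right L1_loc_integrable f)
  have R: "\<bar>R s\<bar> \<le> \<bar>exp s - exp t\<bar> * \<bar>\<Phi> s - \<Phi> t\<bar>" if "s \<ge> 0" for s
  proof (cases "t \<le> s")
    case True
    then show ?thesis using Rle[of t s t] split[of t s t] t by (simp add: R_def)
  next
    case False
    then show ?thesis using Rle[of s t t] split[of s t t] that
      by (simp add: R_def abs_minus_commute algebra_simps)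
  qed
  have q: "(q \<longlongrightarrow> exp t) (at t within {0..})"
    using DERIV_exp[of t, THEN has_field_derivative_at_within] by (simp add: has_field_derivative_iff q_def)
  have lim: "(h \<longlongrightarrow> h t) (at t within {0..})" if "continuous_on {0..} h" for h :: "real \<Rightarrow> real"
    using that t by (auto simp: continuous_on_def)
  have "((\<lambda>s. \<bar>q s\<bar> * \<bar>\<Phi> s - \<Phi> t\<bar>) \<longlongrightarrow> \<bar>exp t\<bar> * \<bar>\<Phi> t - \<Phi> t\<bar>) (at t within {0..})"
    unfolding \<Phi>_def by (intro tendsto_intros q lim continuous_on_primitive abs)
  then have "((\<lambda>s. \<bar>q s\<bar> * \<bar>\<Phi> s - \<Phi> t\<bar>) \<longlongrightarrow> 0) (at t within {0..})"
    by simp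
  then have "((\<lambda>s. R s / (s - t)) \<longlongrightarrow> 0) (at t within {0..})"
  proof (rule Lim_null_comparison[rotated])
    show "\<forall>\<^sub>F s in at t within {0..}. norm (R s / (s - t)) \<le> \<bar>q s\<bar> * \<bar>\<Phi> s - \<Phi> t\<bar>"
      unfolding eventually_at_filter
      by (intro always_eventually allI impI) (use R in \<open>auto simp: q_def abs_mult divide_right_mono\<close>)
  qed
  then have "((\<lambda>s. R s / (s - t) - q s * primitive f s) \<longlongrightarrow> 0 - exp t * primitive f t) (at t within {0..})"
    by (intro tendsto_intros q lim continuous_on_primitive f)
  moreover have "(P s - exp s * primitive f s - (P t - exp t * primitive f t)) / (s - t)
      = R s / (s - t) - q s * primitive f s" for s
  proof -
    have "P s - exp s * primitive f s - (P t - exp t * primitive f t) = R s - (exp s - exp t) * primitive f s"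
      by (simp add: R_def algebra_simps)
    then show ?thesis by (simp only: q_def times_divide_eq_left diff_divide_distrib[of "R s"])
  qed
  ultimately show ?thesis
    unfolding has_field_derivative_iff by (simp add: P_def)
qed

lemma y1_eq:
  assumes f: "f \<in> L1_loc {0..}" and t: "t \<ge> 0"
  shows "y1 f t = primitive f t - lag f t"
proof -
  \<comment> \<open>The derivative of the first two terms is \<open>- exp t * primitive f t\<close>;
    that of \<open>exp t * lag f t\<close> is \<open>exp t * primitive f t\<close> by the equation
    for \<open>lag\<close>. So \<open>G\<close> is constant.\<close>
  define G where "G = (\<lambda>t. integral {0..t} (\<lambda>s. exp s * f s) - exp t * primitive f t + exp t * lag f t)"
  have "(G has_real_derivative 0) (at t within {0..})" if "t \<ge> 0" for t
    unfolding G_def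
    by (rule derivative_eq_intros exp_weighted_integral_has_derivative[OF f that] lag_deriv[OF f that]
        DERIV_exp[THEN has_field_derivative_at_within] | simp add: algebra_simps)+
  from DERIV_zero_ge0_imp_eq[OF this t] have "G t = G 0" .
  also have "\<dots> = 0" by (simp add: G_def lag_0[OF f])
  finally have "integral {0..t} (\<lambda>s. exp s * f s) = exp t * (primitive f t - lag f t)"
    by (simp add: G_def algebra_simps)
  have ai: "(\<lambda>s. exp (- (t - s)) * f s) absolutely_integrable_on {0..t}"
    by (rule absolutely_integrable_bounded_measurable_product_real)
      (use L1_loc_absolutely_integrable[OF f] in \<open>auto intro!: continuous_imp_measurable_on_sets_lebesgue continuous_intros compact_imp_bounded compact_continuous_image\<close>)
  have "y1 f t = integral {0..t} (\<lambda>s. exp (- t) * (exp s * f s))"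
    unfolding y1_def set_lebesgue_integral_eq_integral(2)[OF ai]
    by (intro integral_cong) (simp add: exp_diff exp_minus field_simps)
  also have "\<dots> = exp (- t) * integral {0..t} (\<lambda>s. exp s * f s)" by simp
  also have "\<dots> = primitive f t - lag f t"
    unfolding \<open>integral {0..t} (\<lambda>s. exp s * f s) = _\<close> by (simp add: exp_minus)
  finally show ?thesis .
qed

lemma f_theta_eq:
  assumes f: "f \<in> L1_loc {0..}" and "t \<ge> \<theta>" "\<theta> \<ge> 0"
  shows "f_theta f \<theta> t = primitive f t - primitive f (t - \<theta>)"
proof -
  have "f_theta f \<theta> t = integral {max (t - \<theta>) 0..t} f"
    unfolding f_theta_def
    by (rule set_lebesgue_integral_eq_integral(2)[OF L1_loc_absolutely_integrable[OF f]]) simp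
  then show ?thesis
    using assms primitive_diff[OF f, of "t - \<theta>" t] by (simp add: max_absorb1)
qed

subsection \<open>Solutions of the second-order equation\<close>

text \<open>The unknown \<^term>\<open>r\<close> is \<^term>\<open>deriv_ge0 x\<close> minus the primitive of the forcing term. This turns the
  equation into a system with continuous data.\<close>

definition regular_system :: "(real \<Rightarrow> real) \<Rightarrow> real \<Rightarrow> real \<Rightarrow> (real \<Rightarrow> real) \<Rightarrow> (real \<Rightarrow> real) \<Rightarrow> bool" where
  "regular_system f a b x r \<longleftrightarrow> (\<forall>t\<ge>0.
     (x has_real_derivative r t + primitive f t) (at t within {0..}) \<and>
     (r has_real_derivative - a * (r t + primitive f t) - b * x t) (at t within {0..}))"

text \<open>The second-order operator factors into two first-order ones with coefficients
  \<open>\<mu>\<close> and \<open>\<nu>\<close>. The combination \<open>q = r + \<nu> * x\<close>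
  solves an equation driven by the primitive alone, and \<open>x\<close> then solves one driven by
  \<open>q\<close> and the primitive.\<close>

lemma regular_system_exists:
  assumes f: "f \<in> L1_loc {0..}" and "a > 0" "b > 0"
  shows "\<exists>x r. x 0 = \<xi>0 \<and> r 0 = \<xi>1 \<and> regular_system f a b x r"
proof -
  obtain \<nu> \<mu> :: complex where roots: "\<nu> + \<mu> = of_real a" "\<nu> * \<mu> = of_real b"
    using quadratic_roots_positive_real_part[OF assms(2,3)] by metis
  let ?F = "\<lambda>t. complex_of_real (primitive f t)"
  have cF: "continuous_on {0..} ?F" by (intro continuous_intros continuous_on_primitive f)
  obtain q where q: "q 0 = of_real \<xi>1 + \<nu> * of_real \<xi>0"
    "\<And>t. t \<ge> 0 \<Longrightarrow> (q has_vector_derivative - \<mu> * ?F t - \<mu> * q t) (at t within {0..})"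
    using linear_ode_exists[of "\<lambda>t. - \<mu> * ?F t" "of_real \<xi>1 + \<nu> * of_real \<xi>0" \<mu>]
      continuous_on_mult[OF continuous_on_const cF] by metis
  have "continuous_on {0..} (\<lambda>t. q t + ?F t)"
    by (intro continuous_on_add cF continuous_on_vector_derivative[OF q(2)]) simp
  then obtain z where z: "z 0 = of_real \<xi>0"
    "\<And>t. t \<ge> 0 \<Longrightarrow> (z has_vector_derivative q t + ?F t - \<nu> * z t) (at t within {0..})"
    using linear_ode_exists[of "\<lambda>t. q t + ?F t" "of_real \<xi>0" \<nu>] by metis
  \<comment> \<open>The factors may be complex, but the system has real coefficients and data, so
    real parts solve it again.\<close>
  define x r where "x = (\<lambda>t. Re (z t))" and "r = (\<lambda>t. Re (q t - \<nu> * z t))"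
  have "(x has_real_derivative r t + primitive f t) (at t within {0..})" if "t \<ge> 0" for t
  proof -
    have "(x has_vector_derivative Re (q t + ?F t - \<nu> * z t)) (at t within {0..})"
      unfolding x_def by (rule bounded_linear.has_vector_derivative[OF bounded_linear_Re z(2)[OF that]])
    then show ?thesis by (simp add: has_real_derivative_iff_has_vector_derivative r_def algebra_simps)
  qed
  moreover have "(r has_real_derivative - a * (r t + primitive f t) - b * x t) (at t within {0..})" if "t \<ge> 0" for t
  proof -
    have "((\<lambda>t. q t - \<nu> * z t) has_vector_derivative
        (- \<mu> * ?F t - \<mu> * q t) - \<nu> * (q t + ?F t - \<nu> * z t)) (at t within {0..})"
      by (intro has_vector_derivative_diff has_vector_derivative_mult_right q z that)
    moreover have "(- \<mu> * ?F t - \<mu> * q t) - \<nu> * (q t + ?F t - \<nu> * z t)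
        = - (\<nu> + \<mu>) * (q t - \<nu> * z t + ?F t) - \<nu> * \<mu> * z t"
      by (simp add: algebra_simps)
    ultimately have "((\<lambda>t. q t - \<nu> * z t) has_vector_derivative
        - of_real a * (q t - \<nu> * z t + ?F t) - of_real b * z t) (at t within {0..})"
      by (simp only: roots)
    then have "(r has_vector_derivative Re (- of_real a * (q t - \<nu> * z t + ?F t) - of_real b * z t)) (at t within {0..})"
      unfolding r_def by (rule bounded_linear.has_vector_derivative[OF bounded_linear_Re])
    moreover have "Re (- of_real a * (q t - \<nu> * z t + ?F t) - of_real b * z t) = - a * (r t + primitive f t) - b * x t"
      by (simp add: r_def x_def algebra_simps)
    ultimately show ?thesis by (simp add: has_real_derivative_iff_has_vector_derivative)
  qed
  moreover have "x 0 = \<xi>0" "r 0 = \<xi>1" using q(1) z(1) by (auto simp: x_def r_def)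
  ultimately show ?thesis unfolding regular_system_def by blast
qed

section \<open>From the regular system to the equation, and uniqueness\<close>

lemma DERIV_ge0_transform:
  assumes "(g has_real_derivative d) (at t within {0..})" "t \<ge> 0" "\<And>s. s \<ge> 0 \<Longrightarrow> h s = g s"
  shows "(h has_real_derivative d) (at t within {0..})"
  using assms unfolding has_field_derivative_def by (intro has_derivative_transform[of t "{0..}" h g]) auto

lemma deriv_ge0_eq:
  assumes "(x has_real_derivative d) (at t within {0..})" "t \<ge> 0"
  shows "deriv_ge0 x t = d"
  unfolding deriv_ge0_def
  by (rule vector_derivative_within[OF at_within_ge0_neq_bot[OF assms(2)]])
    (use assms(1) in \<open>simp add: has_real_derivative_iff_has_vector_derivative\<close>)

lemma regular_system_deriv_ge0:
  assumes "regular_system f a b x r" "t \<ge> 0"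
  shows "deriv_ge0 x t = r t + primitive f t"
  using assms by (intro deriv_ge0_eq) (auto simp: regular_system_def)

lemma AE_lebesgue_negligible:
  assumes "negligible N" "\<And>t. t \<in> S \<Longrightarrow> t \<notin> N \<Longrightarrow> P t"
  shows "AE t\<in>S in lebesgue. P t"
  by (rule AE_I'[of N]) (use assms in \<open>auto simp: negligible_iff_null_sets\<close>)

lemma abs_continuous_on_cong:
  assumes "\<And>t. t \<in> {c..d} \<Longrightarrow> g t = h t"
  shows "abs_continuous_on {c..d} g = abs_continuous_on {c..d} h"
proof -
  have "abs_continuous_on {c..d} h" if g: "abs_continuous_on {c..d} g" and eq: "\<And>t. t \<in> {c..d} \<Longrightarrow> g t = h t" for g h
    unfolding abs_continuous_on_def
  proof (intro allI impI)
    fix \<epsilon> :: real assume "\<epsilon> > 0"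
    then obtain \<delta> where \<delta>: "\<delta> > 0" "\<And>D. D division_of \<Union>D \<and> \<Union>D \<subseteq> {c..d} \<and> (\<Sum>K\<in>D. Sup K - Inf K) < \<delta> \<Longrightarrow>
        (\<Sum>K\<in>D. \<bar>g (Sup K) - g (Inf K)\<bar>) < \<epsilon>"
      using g unfolding abs_continuous_on_def by meson
    show "\<exists>\<delta>>0. \<forall>D. D division_of \<Union>D \<and> \<Union>D \<subseteq> {c..d} \<and> (\<Sum>K\<in>D. Sup K - Inf K) < \<delta> \<longrightarrow>
        (\<Sum>K\<in>D. \<bar>h (Sup K) - h (Inf K)\<bar>) < \<epsilon>"
    proof (intro exI[of _ \<delta>] conjI allI impI \<delta>(1))
      fix D :: "real set set" assume D: "D division_of \<Union>D \<and> \<Union>D \<subseteq> {c..d} \<and> (\<Sum>K\<in>D. Sup K - Inf K) < \<delta>"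
      have "g (Sup K) = h (Sup K) \<and> g (Inf K) = h (Inf K)" if "K \<in> D" for K
      proof -
        obtain l r where K: "K = {l..r}" "l \<le> r" "Sup K = r" "Inf K = l"
          using division_real_interval[OF conjunct1[OF D] \<open>K \<in> D\<close>] by blast
        moreover have "K \<subseteq> {c..d}" using D that by blast
        ultimately show ?thesis by (auto intro!: eq)
      qed
      then show "(\<Sum>K\<in>D. \<bar>h (Sup K) - h (Inf K)\<bar>) < \<epsilon>"
        using \<delta>(2)[OF D] by simp
    qed
  qed
  then show ?thesis using assms by metis
qed

text \<open>The derivative of \<open>x\<close> splits into the continuously differentiable
  \<open>r\<close> and the primitive of \<open>f\<close>. The latter is absolutely continuous and
  supplies the term \<open>f t\<close> almost everywhere.\<close>

lemma regular_system_is_solution: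
  assumes f: "f \<in> L1_loc {0..}" and sys: "regular_system f a b x r"
  shows "is_solution f a b (x 0) (r 0) x"
  unfolding is_solution_def
proof (intro conjI)
  let ?v = "\<lambda>t. r t + primitive f t"
  have x': "(x has_real_derivative ?v t) (at t within {0..})"
    and r': "(r has_real_derivative - a * ?v t - b * x t) (at t within {0..})" if "t \<ge> 0" for t
    using sys that by (auto simp: regular_system_def)
  have v: "deriv_ge0 x t = ?v t" if "t \<in> {0..}" for t
    using regular_system_deriv_ge0[OF sys] that by simp
  have cont: "continuous_on {0..} x" "continuous_on {0..} r"
    using DERIV_continuous[OF x'] DERIV_continuous[OF r'] by (auto simp: continuous_on_eq_continuous_within)
  have contv: "continuous_on {0..} ?v"
    by (intro continuous_on_add cont continuous_on_primitive f)
  show "x differentiable_on {0..}"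
    unfolding differentiable_on_def differentiable_def using x' by (auto simp: has_field_derivative_def)
  show "continuous_on {0..} (deriv_ge0 x)"
    using contv continuous_on_cong[of "{0..}" "{0..}" "deriv_ge0 x" ?v] v by simp
  show "locally_abs_continuous_on {0..} (deriv_ge0 x)"
    unfolding locally_abs_continuous_on_def
  proof (intro allI impI)
    fix c d :: real assume cd: "{c..d} \<subseteq> {0..}"
    show "abs_continuous_on {c..d} (deriv_ge0 x)"
    proof (cases "c \<le> d")
      case True
      then have c: "c \<ge> 0" using cd by auto
      have "abs_continuous_on {c..d} r"
      proof (rule abs_continuous_on_C1)
        show "(r has_real_derivative - a * ?v t - b * x t) (at t within {c..d})" if "t \<in> {c..d}" for t
          using r'[of t] that cd by (auto intro: has_field_derivative_subset)
        show "continuous_on {c..d} (\<lambda>t. - a * ?v t - b * x t)"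
          by (rule continuous_on_subset[OF _ cd]) (intro continuous_intros contv cont)
      qed
      then have "abs_continuous_on {c..d} ?v"
        by (intro abs_continuous_on_add abs_continuous_on_primitive f c)
      then show ?thesis
        using abs_continuous_on_cong[of c d "deriv_ge0 x" ?v] v cd by auto
    qed (auto intro: abs_continuous_on_lipschitz[of _ _ 0])
  qed
  obtain N where N: "negligible N"
    "\<And>t. t \<notin> N \<Longrightarrow> t \<ge> 0 \<Longrightarrow> (primitive f has_real_derivative f t) (at t within {0..})"
    using primitive_has_real_derivative_AE[OF f] by blast
  show "AE t\<in>{0..} in lebesgue. \<exists>x''. (deriv_ge0 x has_real_derivative x'') (at t within {0..}) \<and>
        x'' + a * deriv_ge0 x t + b * x t = f t"
  proof (rule AE_lebesgue_negligible[OF N(1)])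
    fix t :: real assume t: "t \<in> {0..}" "t \<notin> N"
    have "(?v has_real_derivative - a * ?v t - b * x t + f t) (at t within {0..})"
      using t by (intro DERIV_add r' N) auto
    then have "(deriv_ge0 x has_real_derivative - a * ?v t - b * x t + f t) (at t within {0..})"
      by (rule DERIV_ge0_transform) (use t v in auto)
    then show "\<exists>x''. (deriv_ge0 x has_real_derivative x'') (at t within {0..}) \<and>
        x'' + a * deriv_ge0 x t + b * x t = f t"
      using v[OF t(1)] by (intro exI conjI) (assumption, simp)
  qed
  show "deriv_ge0 x 0 = r 0" using v[of 0] by simp
qed simp

lemma is_solution_deriv:
  assumes "is_solution f a b \<xi>0 \<xi>1 x" "t \<ge> 0"
  shows "(x has_real_derivative deriv_ge0 x t) (at t within {0..})"
proof -
  have "x differentiable (at t within {0..})"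
    using assms by (auto simp: is_solution_def differentiable_on_def)
  then show ?thesis
    unfolding deriv_ge0_def by (simp add: vector_derivative_works has_real_derivative_iff_has_vector_derivative)
qed

text \<open>The difference \<open>d\<close> of two solutions satisfies the homogeneous equation everywhere, since
  \<open>d' + a d\<close> plus the integral of \<open>b d\<close> is absolutely continuous with
  derivative zero almost everywhere. Then the energy \<open>(d')\<^sup>2 + b d\<^sup>2\<close> is nonincreasing.\<close>

lemma is_solution_unique:
  assumes "a > 0" "b > 0"
    and sol: "is_solution f a b \<xi>0 \<xi>1 x" "is_solution f a b \<xi>0 \<xi>1 y" and "t \<ge> 0"
  shows "x t = y t"
proof -
  define d where "d = (\<lambda>t. x t - y t)"
  define \<delta> where "\<delta> = (\<lambda>t. deriv_ge0 x t - deriv_ge0 y t)"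
  define I where "I = (\<lambda>t. integral {0..t} d)"
  define h where "h = (\<lambda>t. \<delta> t + (a * d t + b * I t))"
  have d': "(d has_real_derivative \<delta> t) (at t within {0..})" if "t \<ge> 0" for t
    unfolding d_def \<delta>_def using is_solution_deriv sol that by (intro DERIV_diff) auto
  have contd: "continuous_on {0..} d"
    using DERIV_continuous[OF d'] by (auto simp: continuous_on_eq_continuous_within)
  have cont\<delta>: "continuous_on {0..} \<delta>"
    unfolding \<delta>_def using sol by (intro continuous_on_diff) (auto simp: is_solution_def)
  have I': "(I has_real_derivative d t) (at t within {0..})" if "t \<ge> 0" for t
    using has_vector_derivative_integral_ge0[OF contd that]
    by (simp add: I_def has_real_derivative_iff_has_vector_derivative)
  have ad: "((\<lambda>t. a * d t + b * I t) has_real_derivative a * \<delta> t + b * d t) (at t within {0..})" if "t \<ge> 0" for t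
    by (intro DERIV_add DERIV_cmult d' I' that)
  have init: "d 0 = 0" "\<delta> 0 = 0" "I 0 = 0"
    using sol by (auto simp: d_def \<delta>_def I_def is_solution_def)
  have h0: "h t = 0" if t: "t \<ge> 0" for t
  proof -
    have "AE t in lebesgue. t \<in> {0..} \<longrightarrow> (h has_real_derivative 0) (at t within {0..})"
    proof -
      have "AE t\<in>{0..} in lebesgue. \<exists>x''. (deriv_ge0 x has_real_derivative x'') (at t within {0..}) \<and>
          x'' + a * deriv_ge0 x t + b * x t = f t"
        and "AE t\<in>{0..} in lebesgue. \<exists>x''. (deriv_ge0 y has_real_derivative x'') (at t within {0..}) \<and>
          x'' + a * deriv_ge0 y t + b * y t = f t"
        using sol by (auto simp: is_solution_def)
      then show ?thesis
      proof (eventually_elim, safe)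
        fix t x2 y2 assume "0 \<le> t"
          and "(deriv_ge0 x has_real_derivative x2) (at t within {0..})" "x2 + a * deriv_ge0 x t + b * x t = f t"
          and "(deriv_ge0 y has_real_derivative y2) (at t within {0..})" "y2 + a * deriv_ge0 y t + b * y t = f t"
        then have "(h has_real_derivative (x2 - y2) + (a * \<delta> t + b * d t)) (at t within {0..})"
          unfolding h_def by (intro DERIV_add ad) (auto simp: \<delta>_def intro: DERIV_diff)
        moreover have "(x2 - y2) + (a * \<delta> t + b * d t) = 0"
          using \<open>x2 + _ + _ = f t\<close> \<open>y2 + _ + _ = f t\<close> by (simp add: \<delta>_def d_def algebra_simps)
        ultimately show "(h has_real_derivative 0) (at t within {0..})" by simp
      qed
    qed
    then obtain N where N: "N \<in> null_sets lebesgue"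
      "{t \<in> space lebesgue. \<not> (t \<in> {0..} \<longrightarrow> (h has_real_derivative 0) (at t within {0..}))} \<subseteq> N"
      unfolding eventually_ae_filter by blast
    have "h t = h 0"
    proof (rule abs_continuous_on_derivative_zero_imp_eq[where h = h and N = N])
      show "negligible N" using N by (simp add: negligible_iff_null_sets)
      show "(h has_real_derivative 0) (at s within {0..t})" if "s \<in> {0..t} - N" for s
        using N(2) that by (auto intro: has_field_derivative_subset[of _ _ _ "{0..}"])
      have "abs_continuous_on {0..t} \<delta>"
        unfolding \<delta>_def using sol
        by (intro abs_continuous_on_diff) (auto simp: is_solution_def locally_abs_continuous_on_def)
      moreover have "abs_continuous_on {0..t} (\<lambda>t. a * d t + b * I t)"
      proof (rule abs_continuous_on_C1)
        show "((\<lambda>t. a * d t + b * I t) has_real_derivative a * \<delta> s + b * d s) (at s within {0..t})"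
          if "s \<in> {0..t}" for s
          using ad[of s] that by (auto intro: has_field_derivative_subset)
        show "continuous_on {0..t} (\<lambda>t. a * \<delta> t + b * d t)"
          by (rule continuous_on_subset[of "{0..}"]) (auto intro!: continuous_intros contd cont\<delta>)
      qed
      ultimately show "abs_continuous_on {0..t} h"
        unfolding h_def by (rule abs_continuous_on_add)
    qed (use t in auto)
    then show ?thesis by (simp add: h_def init)
  qed
  \<comment> \<open>Since \<open>h\<close> vanishes, \<open>\<delta>\<close> equals
    \<open>- (a * d + b * I)\<close>, which is differentiable at every point; the exceptional null
    set is gone.\<close>
  have \<delta>': "(\<delta> has_real_derivative - (a * \<delta> t + b * d t)) (at t within {0..})" if "t \<ge> 0" for t
  proof (rule DERIV_ge0_transform)
    show "((\<lambda>t. - (a * d t + b * I t)) has_real_derivative - (a * \<delta> t + b * d t)) (at t within {0..})"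
      by (intro DERIV_minus ad that)
    show "\<delta> s = - (a * d s + b * I s)" if "s \<ge> 0" for s
      using h0[of s] that by (simp add: h_def)
  qed (use that in auto)
  define E where "E = (\<lambda>t. (\<delta> t)\<^sup>2 + b * (d t)\<^sup>2)"
  have E': "(E has_real_derivative - 2 * a * (\<delta> t)\<^sup>2) (at t within {0..})" if "t \<ge> 0" for t
  proof -
    have "(E has_real_derivative (- (a * \<delta> t + b * d t) * \<delta> t + - (a * \<delta> t + b * d t) * \<delta> t) +
        b * (\<delta> t * d t + \<delta> t * d t)) (at t within {0..})"
      unfolding E_def power2_eq_square by (intro DERIV_add DERIV_mult DERIV_cmult \<delta>' d' that)
    then show ?thesis by (simp add: power2_eq_square algebra_simps)
  qed
  have "E t \<le> E 0"
  proof (rule DERIV_nonpos_imp_decreasing_open[OF \<open>t \<ge> 0\<close>])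
    show "continuous_on {0..t} E"
      unfolding E_def
      by (intro continuous_intros continuous_on_subset[OF contd] continuous_on_subset[OF cont\<delta>]) auto
    fix s assume s: "0 < s" "s < t"
    then have "at s within {0..} = at s" by (intro at_within_interior) auto
    then show "\<exists>y. (E has_real_derivative y) (at s) \<and> y \<le> 0"
      using E'[of s] s \<open>a > 0\<close> by (intro exI[of _ "- 2 * a * (\<delta> s)\<^sup>2"]) auto
  qed
  then have "(\<delta> t)\<^sup>2 + b * (d t)\<^sup>2 \<le> 0" by (simp add: E_def init)
  with zero_le_power2[of "\<delta> t"] have "b * (d t)\<^sup>2 \<le> 0" by linarith
  then show ?thesis using \<open>b > 0\<close> by (simp add: d_def mult_le_0_iff)
qed

lemma regular_system_cong:
  assumes "regular_system f a b x r" "\<And>t. t \<ge> 0 \<Longrightarrow> x t = y t"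
  shows "regular_system f a b y r"
  using assms(1) unfolding regular_system_def
  by (auto simp: assms(2) intro!: DERIV_ge0_transform[of x _ _ y])

text \<open>This resolves the definite description: a solution of the system, cut to 0 at negative
  arguments, is the only candidate. The asymptotic arguments can then use the system in place of the
  almost-everywhere equation.\<close>

lemma ode_solution_regular_system:
  assumes f: "f \<in> L1_loc {0..}" and ab: "a > 0" "b > 0"
  shows "\<exists>r. regular_system f a b (ode_solution f a b \<xi>0 \<xi>1) r"
proof -
  obtain x0 r where x0: "x0 0 = \<xi>0" "r 0 = \<xi>1" "regular_system f a b x0 r"
    using regular_system_exists[OF assms] by blast
  define x where "x = (\<lambda>t. if t < 0 then 0 else x0 t)"
  have x: "regular_system f a b x r"
    by (rule regular_system_cong[OF x0(3)]) (simp add: x_def)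
  have "x 0 = \<xi>0" using x0 by (simp add: x_def)
  then have sol: "is_solution f a b \<xi>0 \<xi>1 x"
    using regular_system_is_solution[OF f x] x0(2) by simp
  have "ode_solution f a b \<xi>0 \<xi>1 = x"
    unfolding ode_solution_def
  proof (rule the_equality)
    show "is_solution f a b \<xi>0 \<xi>1 x \<and> (\<forall>t<0. x t = 0)" using sol by (simp add: x_def)
    fix y assume y: "is_solution f a b \<xi>0 \<xi>1 y \<and> (\<forall>t<0. y t = 0)"
    show "y = x"
    proof
      fix t show "y t = x t"
        using is_solution_unique[OF ab _ sol, of y t] y by (cases "t < 0") (auto simp: x_def)
    qed
  qed
  then show ?thesis using x by blast
qed

text \<open>Subtracting \<open>y\<close> from the derivative of \<open>x\<close> gives
  \<open>p\<close>, and the pair of \<open>x\<close> and \<open>p\<close> solves a system driven by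
  \<open>y\<close> alone. By the factorization, \<open>q = p + \<nu> * x\<close> decays with rate
  \<open>\<mu>\<close> under a multiple of \<open>y\<close>, and then \<open>x\<close> decays with
  rate \<open>\<nu>\<close> under \<open>q + y\<close>.\<close>

lemma regular_system_tendsto_0:
  assumes f: "f \<in> L1_loc {0..}" and ab: "a > 0" "b > 0"
    and sys: "regular_system f a b x r"
    and y: "((\<lambda>t. primitive f t - lag f t) \<longlongrightarrow> 0) at_top"
  shows "(x \<longlongrightarrow> 0) at_top" "((\<lambda>t. r t + primitive f t) \<longlongrightarrow> 0) at_top"
proof -
  obtain \<nu> \<mu> :: complex where roots: "\<nu> + \<mu> = of_real a" "\<nu> * \<mu> = of_real b" "Re \<nu> > 0" "Re \<mu> > 0"
    using quadratic_roots_positive_real_part[OF ab] by metis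
  define y where "y = (\<lambda>t. primitive f t - lag f t)"
  define p where "p = (\<lambda>t. r t + lag f t)"
  define q where "q = (\<lambda>t. of_real (p t) + \<nu> * of_real (x t))"
  have cy: "((\<lambda>t. complex_of_real (y t)) \<longlongrightarrow> 0) at_top"
    using tendsto_of_real[OF assms(5), where 'a = complex] by (simp add: y_def)
  have x': "((\<lambda>t. complex_of_real (x t)) has_vector_derivative of_real (p t + y t)) (at t within {0..})" if "t \<ge> 0" for t
    using sys that
    by (intro has_vector_derivative_of_real) (auto simp: regular_system_def p_def y_def)
  have p': "((\<lambda>t. complex_of_real (p t)) has_vector_derivative of_real (- a * p t - b * x t + (1 - a) * y t)) (at t within {0..})"
    if "t \<ge> 0" for t
  proof (rule has_vector_derivative_of_real)
    have "(p has_real_derivative (- a * (r t + primitive f t) - b * x t) + (primitive f t - lag f t)) (at t within {0..})"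
      unfolding p_def by (intro DERIV_add lag_deriv[OF f that]) (use sys that in \<open>auto simp: regular_system_def\<close>)
    also have "(- a * (r t + primitive f t) - b * x t) + (primitive f t - lag f t) = - a * p t - b * x t + (1 - a) * y t"
      by (simp add: p_def y_def algebra_simps)
    finally show "(p has_real_derivative - a * p t - b * x t + (1 - a) * y t) (at t within {0..})" .
  qed
  have "(q \<longlongrightarrow> 0) at_top"
  proof (rule linear_ode_complex_tendsto_0[of 0 q "\<lambda>t. (1 - \<mu>) * of_real (y t)" \<mu>])
    fix t :: real assume t: "t \<ge> 0"
    have "(q has_vector_derivative of_real (- a * p t - b * x t + (1 - a) * y t) + \<nu> * of_real (p t + y t)) (at t within {0..})"
      unfolding q_def by (intro has_vector_derivative_add has_vector_derivative_mult_right p' x' t)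
    moreover have "of_real (- a * p t - b * x t + (1 - a) * y t) + \<nu> * of_real (p t + y t)
        = (1 - \<mu>) * of_real (y t) - \<mu> * q t"
      unfolding of_real_add of_real_diff of_real_mult of_real_minus roots(1,2)[symmetric] q_def
      by (simp add: algebra_simps)
    ultimately show "(q has_vector_derivative (1 - \<mu>) * of_real (y t) - \<mu> * q t) (at t within {0..})"
      by simp
  next
    show "((\<lambda>t. (1 - \<mu>) * of_real (y t)) \<longlongrightarrow> 0) at_top" by (rule tendsto_mult_right_zero[OF cy])
  qed (fact roots)
  note q0 = this
  have cx: "((\<lambda>t. complex_of_real (x t)) \<longlongrightarrow> 0) at_top"
  proof (rule linear_ode_complex_tendsto_0[of 0 _ "\<lambda>t. q t + of_real (y t)" \<nu>])
    show "((\<lambda>t. complex_of_real (x t)) has_vector_derivative q t + of_real (y t) - \<nu> * of_real (x t)) (at t within {0..})"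
      if "t \<ge> 0" for t using x'[OF that] by (simp add: q_def)
    show "((\<lambda>t. q t + of_real (y t)) \<longlongrightarrow> 0) at_top" by (rule tendsto_add_zero[OF q0 cy])
  qed (fact roots)
  then show "(x \<longlongrightarrow> 0) at_top" using tendsto_Re[OF cx] by simp
  \<comment> \<open>This combination is \<open>p + y\<close>, which is the derivative of
    \<open>x\<close>.\<close>
  have "((\<lambda>t. q t - \<nu> * of_real (x t) + of_real (y t)) \<longlongrightarrow> 0 - \<nu> * 0 + 0) at_top"
    by (intro tendsto_intros q0 cx cy)
  from tendsto_Re[OF this] show "((\<lambda>t. r t + primitive f t) \<longlongrightarrow> 0) at_top"
    by (simp add: q_def p_def y_def)
qed

text \<open>In the difference \<open>m\<close> of the smoothing and the derivative of
  \<open>x\<close> the primitive cancels, so \<open>m\<close> is differentiable; it solves a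
  decaying equation whose forcing is a combination of \<open>x\<close> and its derivative.\<close>

lemma regular_system_imp_smoothing_tendsto_0:
  assumes f: "f \<in> L1_loc {0..}" and sys: "regular_system f a b x r"
    and x: "(x \<longlongrightarrow> 0) at_top" and v: "((\<lambda>t. r t + primitive f t) \<longlongrightarrow> 0) at_top"
  shows "((\<lambda>t. primitive f t - lag f t) \<longlongrightarrow> 0) at_top"
proof -
  define m where "m = (\<lambda>t. - lag f t - r t)"
  have "(m \<longlongrightarrow> 0) at_top"
  proof (rule linear_ode_real_tendsto_0)
    fix t :: real assume t: "t \<ge> 0"
    have "(m has_real_derivative - (primitive f t - lag f t) - (- a * (r t + primitive f t) - b * x t)) (at t within {0..})"
      unfolding m_def using sys t
      by (intro DERIV_diff DERIV_minus lag_deriv[OF f t]) (auto simp: regular_system_def)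
    then show "(m has_real_derivative ((a - 1) * (r t + primitive f t) + b * x t) - m t) (at t within {0..})"
      by (simp add: m_def algebra_simps)
  next
    have "((\<lambda>t. (a - 1) * (r t + primitive f t) + b * x t) \<longlongrightarrow> (a - 1) * 0 + b * 0) at_top"
      by (intro tendsto_intros x v)
    then show "((\<lambda>t. (a - 1) * (r t + primitive f t) + b * x t) \<longlongrightarrow> 0) at_top" by simp
  qed
  from tendsto_add_zero[OF this v] show ?thesis by (simp add: m_def)
qed

subsection \<open>Differences of the primitive\<close>

lemma DERIV_real_bound:
  fixes g :: "real \<Rightarrow> real"
  assumes "\<And>s. s \<in> {l..r} \<Longrightarrow> (g has_real_derivative g' s) (at s within {l..r})"
    and "\<And>s. s \<in> {l..r} \<Longrightarrow> \<bar>g' s\<bar> \<le> B" and "l \<le> r"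
  shows "\<bar>g r - g l\<bar> \<le> B * (r - l)"
  using field_differentiable_bound[of "{l..r}" g g' B r l] assms by auto

text \<open>The increment of the primitive is that of \<open>?y\<close> plus that of
  \<open>lag f\<close>, and \<open>lag f\<close> has derivative \<open>?y\<close>. All contributions
  are thus controlled by \<open>?y\<close> on the window from \<open>t - 1\<close> to
  \<open>t\<close>, whatever \<open>\<theta>\<close> is.\<close>

lemma smoothing_tendsto_0_imp_f_theta_uniform:
  assumes f: "f \<in> L1_loc {0..}" and y: "((\<lambda>t. primitive f t - lag f t) \<longlongrightarrow> 0) at_top"
  shows "uniform_limit {0..1} (\<lambda>t \<theta>. f_theta f \<theta> t) (\<lambda>\<theta>. 0) at_top"
  unfolding uniform_limit_iff
proof (intro allI impI)
  fix e :: real assume "e > 0"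
  let ?y = "\<lambda>t. primitive f t - lag f t"
  obtain T where T: "\<And>t. t \<ge> T \<Longrightarrow> \<bar>?y t\<bar> < e / 4"
    using tendstoD[OF y, of "e / 4"] \<open>e > 0\<close> by (auto simp: eventually_at_top_linorder)
  show "\<forall>\<^sub>F t in at_top. \<forall>\<theta>\<in>{0..1}. dist (f_theta f \<theta> t) 0 < e"
    using eventually_ge_at_top[of "max T 0 + 1"]
  proof eventually_elim
    case (elim t)
    show ?case
    proof
      fix \<theta> :: real assume \<theta>: "\<theta> \<in> {0..1}"
      have "\<bar>lag f t - lag f (t - \<theta>)\<bar> \<le> (e / 4) * (t - (t - \<theta>))"
      proof (rule DERIV_real_bound)
        fix s assume s: "s \<in> {t - \<theta>..t}"
        \<comment> \<open>The \<open>+ 1\<close> in the threshold for \<open>t\<close> leaves room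
          for the largest shift.\<close>
        then have "s \<ge> 0" "s \<ge> T" using elim \<theta> by auto
        show "(lag f has_real_derivative ?y s) (at s within {t - \<theta>..t})"
          by (rule has_field_derivative_subset[OF lag_deriv[OF f \<open>s \<ge> 0\<close>]]) (use elim \<theta> in auto)
        show "\<bar>?y s\<bar> \<le> e / 4" using T[OF \<open>s \<ge> T\<close>] by simp
      qed (use \<theta> in auto)
      also have "\<dots> \<le> e / 4 * 1" using \<theta> \<open>e > 0\<close> by (intro mult_left_mono) auto
      finally have "\<bar>lag f t - lag f (t - \<theta>)\<bar> \<le> e / 4" by simp
      moreover have "\<bar>?y t\<bar> < e / 4" "\<bar>?y (t - \<theta>)\<bar> < e / 4" using T elim \<theta> by auto
      ultimately have "\<bar>primitive f t - primitive f (t - \<theta>)\<bar> < e" by linarith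
      moreover have "\<theta> \<le> t" "0 \<le> \<theta>" using elim \<theta> by auto
      ultimately show "dist (f_theta f \<theta> t) 0 < e"
        by (simp add: f_theta_eq[OF f])
    qed
  qed
qed

text \<open>Here \<open>g\<close> is the moving average of the primitive over a window of length one; \<open>g\<close> stays close to the
  primitive, and \<open>w = g - lag f\<close> solves \<open>w' = - w + (g(t) - F(t - 1))\<close>, where \<open>F\<close> is the primitive.\<close>

lemma f_theta_uniform_imp_smoothing_tendsto_0:
  assumes f: "f \<in> L1_loc {0..}"
    and unif: "uniform_limit {0..1} (\<lambda>t \<theta>. f_theta f \<theta> t) (\<lambda>\<theta>. 0) at_top"
  shows "((\<lambda>t. primitive f t - lag f t) \<longlongrightarrow> 0) at_top"
proof -
  let ?F = "primitive f"
  define K where "K = (\<lambda>t. integral {0..t} ?F)"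
  define g where "g = (\<lambda>t. K t - K (t - 1))"
  define w where "w = (\<lambda>t. g t - lag f t)"
  have K': "(K has_real_derivative ?F t) (at t within {0..})" if "t \<ge> 0" for t
    using has_vector_derivative_integral_ge0[OF continuous_on_primitive[OF f] that]
    by (simp add: K_def has_real_derivative_iff_has_vector_derivative)
  have at: "at t within {0..} = at t" if "t > 0" for t :: real
    using that by (intro at_within_interior) auto
  have diff: "\<forall>\<^sub>F t in at_top. \<forall>\<theta>\<in>{0..1}. \<bar>?F t - ?F (t - \<theta>)\<bar> < e" if "e > 0" for e
    using unif[unfolded uniform_limit_iff, rule_format, OF that] eventually_ge_at_top[of 1]
    by eventually_elim (use f_theta_eq[OF f] in auto)
  have Fg: "((\<lambda>t. ?F t - g t) \<longlongrightarrow> 0) at_top"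
    unfolding tendsto_iff
  proof (intro allI impI)
    fix e :: real assume "e > 0"
    then have "e / 2 > 0" by simp
    show "\<forall>\<^sub>F t in at_top. dist (?F t - g t) 0 < e"
      using diff[OF \<open>e / 2 > 0\<close>] eventually_ge_at_top[of 1]
    proof eventually_elim
      case (elim t)
      \<comment> \<open>With \<open>t\<close> fixed, subtracting \<open>s * ?F t\<close> from
        \<open>K s\<close> turns the increment over the window into \<open>g t - ?F t\<close> and
        the derivative into \<open>?F s - ?F t\<close>, which is uniformly small.\<close>
      have "\<bar>(K t - t * ?F t) - (K (t - 1) - (t - 1) * ?F t)\<bar> \<le> (e / 2) * (t - (t - 1))"
      proof (rule DERIV_real_bound)
        fix s assume s: "s \<in> {t - 1..t}"
        show "((\<lambda>s. K s - s * ?F t) has_real_derivative ?F s - ?F t) (at s within {t - 1..t})"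
          using DERIV_cmult_right[OF DERIV_ident, of "?F t"] s elim
          by (intro DERIV_diff has_field_derivative_subset[OF K']) auto
        show "\<bar>?F s - ?F t\<bar> \<le> e / 2"
          using elim(1)[rule_format, of "t - s"] s by (simp add: abs_minus_commute)
      qed simp
      then have "\<bar>g t - ?F t\<bar> \<le> e / 2" by (simp add: g_def algebra_simps)
      then show ?case using \<open>e > 0\<close> by (simp add: abs_minus_commute)
    qed
  qed
  have F1: "((\<lambda>t. ?F t - ?F (t - 1)) \<longlongrightarrow> 0) at_top"
    unfolding tendsto_iff
  proof (intro allI impI)
    fix e :: real assume "e > 0"
    from diff[OF this] show "\<forall>\<^sub>F t in at_top. dist (?F t - ?F (t - 1)) 0 < e"
      by eventually_elim auto
  qed
  have "(w \<longlongrightarrow> 0) at_top"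
  proof (rule linear_ode_real_tendsto_0)
    \<comment> \<open>From 2 on, both \<open>t\<close> and \<open>t - 1\<close> are interior points
      of the half-line, so two-sided derivatives and the shift rule apply.\<close>
    fix t :: real assume t: "t \<ge> 2"
    have "(K has_real_derivative ?F t) (at t)" "(K has_real_derivative ?F (t - 1)) (at (t - 1))"
      using K'[of t] K'[of "t - 1"] t by (auto simp: at)
    then have "((\<lambda>t. K (t - 1)) has_real_derivative ?F (t - 1)) (at t)"
      using DERIV_shift[of K "?F (t - 1)" t "-1"] by simp
    moreover have "(lag f has_real_derivative ?F t - lag f t) (at t)"
      using lag_deriv[OF f, of t] t by (simp add: at)
    ultimately have "(w has_real_derivative ?F t - ?F (t - 1) - (?F t - lag f t)) (at t)"
      unfolding w_def g_def using \<open>(K has_real_derivative ?F t) (at t)\<close> by (intro DERIV_diff)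
    moreover have "?F t - ?F (t - 1) - (?F t - lag f t) = (g t - ?F (t - 1)) - w t"
      by (simp add: w_def)
    ultimately show "(w has_real_derivative (g t - ?F (t - 1)) - w t) (at t within {2..})"
      by (auto intro: has_field_derivative_at_within)
  next
    show "((\<lambda>t. g t - ?F (t - 1)) \<longlongrightarrow> 0) at_top"
      using tendsto_diff[OF F1 Fg] by simp
  qed
  from tendsto_add_zero[OF this Fg] show ?thesis by (simp add: w_def)
qed

text \<open>Otherwise the complements of the \<open>E n\<close> would be dense and relatively open
  in the unit interval, and their intersection, empty by the covering, would be dense by Baire's
  theorem.\<close>

lemma Baire_interval_nat:
  fixes E :: "nat \<Rightarrow> real set"
  assumes closed: "\<And>n. closed (E n)" and cover: "{0..1} \<subseteq> (\<Union>n. E n)"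
  obtains n \<alpha> \<beta> where "\<alpha> < \<beta>" "{\<alpha>..\<beta>} \<subseteq> {0..1}" "{\<alpha>..\<beta>} \<subseteq> E n"
proof -
  have "\<exists>n. \<not> {0..1} \<subseteq> closure ({0..1} - E n)"
  proof (rule ccontr)
    assume "\<not> ?thesis"
    then have dense: "{0..1} \<subseteq> closure ({0..1} - E n)" for n by blast
    have "{0..1} \<subseteq> closure (\<Inter>(range (\<lambda>n. {0..1} - E n)))"
    proof (rule Baire)
      fix T assume "T \<in> range (\<lambda>n. {0..1} - E n)"
      then obtain n where "T = {0..1} - E n" by blast
      then show "openin (top_of_set {0..1}) T \<and> {0..1} \<subseteq> closure T"
        using dense[of n] openin_open_Int[of "- E n" "{0..1}"] closed[of n] by (simp add: Diff_eq open_Compl)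
    qed auto
    moreover have "\<Inter>(range (\<lambda>n. {0..1} - E n)) = {}" using cover by auto
    ultimately have "{0..1::real} \<subseteq> closure {}" by (simp only:)
    then show False by simp
  qed
  then obtain n x where x: "x \<in> {0..1}" "x \<notin> closure ({0..1} - E n)" by blast
  then obtain r where r: "r > 0" "\<And>z. z \<in> {0..1} - E n \<Longrightarrow> \<not> dist z x < r"
    unfolding closure_approachable by blast
  \<comment> \<open>Half the radius keeps the closed interval inside the open ball; the cut at 0 and
    1 keeps it in the unit interval.\<close>
  define \<alpha> \<beta> where "\<alpha> = max 0 (x - r / 2)" and "\<beta> = min 1 (x + r / 2)"
  have ab: "\<alpha> < \<beta>" "{\<alpha>..\<beta>} \<subseteq> {0..1}"
    using x(1) r(1) by (auto simp: \<alpha>_def \<beta>_def)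
  moreover have "{\<alpha>..\<beta>} \<subseteq> E n"
  proof
    fix z assume z: "z \<in> {\<alpha>..\<beta>}"
    then have "dist z x < r" using r(1) by (simp add: \<alpha>_def \<beta>_def dist_real_def abs_if)
    then show "z \<in> E n" using r(2)[of z] ab(2) z by blast
  qed
  ultimately show ?thesis by (rule that)
qed

text \<open>Baire's theorem makes the convergence uniform for \<open>\<theta>\<close> in some interval, hence for all small shifts
  \<open>\<tau>\<close>; every \<open>\<theta>\<close> is a small shift away from one of finitely many grid points.\<close>

lemma differences_tendsto_0_uniformly:
  fixes F :: "real \<Rightarrow> real"
  assumes cont: "continuous_on {0..} F"
    and lim: "\<And>\<theta>. \<theta> \<in> {0..1} \<Longrightarrow> ((\<lambda>t. F t - F (t - \<theta>)) \<longlongrightarrow> 0) at_top"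
    and "e > 0"
  shows "\<forall>\<^sub>F t in at_top. \<forall>\<theta>\<in>{0..1}. \<bar>F t - F (t - \<theta>)\<bar> < e"
proof -
  define \<epsilon> where "\<epsilon> = e / 4"
  have "\<epsilon> > 0" using \<open>e > 0\<close> by (simp add: \<epsilon>_def)
  \<comment> \<open>The bound \<open>t \<ge> real n + 1\<close> puts \<open>t - \<theta>\<close>
    where \<open>F\<close> is continuous, which makes each \<open>E n\<close> closed.\<close>
  define E where "E = (\<lambda>n::nat. {\<theta> \<in> {0..1}. \<forall>t \<ge> real n + 1. \<bar>F t - F (t - \<theta>)\<bar> \<le> \<epsilon>})"
  have "closed (E n)" for n
  proof -
    have "E n = {0..1} \<inter> (\<Inter>t\<in>{real n + 1..}. {\<theta> \<in> {0..1}. \<bar>F t - F (t - \<theta>)\<bar> \<le> \<epsilon>})"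
      by (auto simp: E_def)
    moreover have "closed {\<theta> \<in> {0..1}. \<bar>F t - F (t - \<theta>)\<bar> \<le> \<epsilon>}" if "t \<ge> real n + 1" for t
      using that
      by (intro continuous_closed_preimage_constant continuous_on_closed_Collect_le continuous_intros continuous_on_compose2[OF cont]) auto
    ultimately show ?thesis by (auto intro!: closed_Int closed_INT)
  qed
  moreover have "{0..1} \<subseteq> (\<Union>n. E n)"
  proof
    fix \<theta> :: real assume \<theta>: "\<theta> \<in> {0..1}"
    obtain T where T: "\<And>t. t \<ge> T \<Longrightarrow> \<bar>F t - F (t - \<theta>)\<bar> < \<epsilon>"
      using tendstoD[OF lim[OF \<theta>] \<open>\<epsilon> > 0\<close>] by (auto simp: eventually_at_top_linorder)
    obtain n where "T \<le> real n" using real_arch_simple by blast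
    then have "\<theta> \<in> E n" using T \<theta> by (auto simp: E_def intro: less_imp_le)
    then show "\<theta> \<in> (\<Union>n. E n)" by blast
  qed
  ultimately obtain n \<alpha> \<beta> where ab: "\<alpha> < \<beta>" "{\<alpha>..\<beta>} \<subseteq> {0..1}" "{\<alpha>..\<beta>} \<subseteq> E n"
    by (rule Baire_interval_nat)
  define \<eta> where "\<eta> = \<beta> - \<alpha>"
  have \<eta>: "\<eta> > 0" using ab by (simp add: \<eta>_def)
  have En: "\<bar>F t - F (t - \<theta>)\<bar> \<le> \<epsilon>" if "\<theta> \<in> {\<alpha>..\<beta>}" "t \<ge> real n + 1" for t \<theta>
    using ab(3) that by (auto simp: E_def)
  \<comment> \<open>The points \<open>s\<close> and \<open>s - \<tau>\<close> are both compared with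
    \<open>s - (\<alpha> + \<tau>)\<close>. The shifts used, \<open>\<alpha> + \<tau>\<close> and
    \<open>\<alpha>\<close>, lie in the interval from Baire's theorem.\<close>
  have small: "\<bar>F s - F (s - \<tau>)\<bar> \<le> 2 * \<epsilon>" if "\<tau> \<in> {0..\<eta>}" "s - \<tau> \<ge> real n + 1" for s \<tau>
  proof -
    have "\<bar>F s - F (s - (\<alpha> + \<tau>))\<bar> \<le> \<epsilon>" "\<bar>F (s - \<tau>) - F ((s - \<tau>) - \<alpha>)\<bar> \<le> \<epsilon>"
      using that ab(1) by (auto intro!: En simp: \<eta>_def)
    moreover have "s - (\<alpha> + \<tau>) = (s - \<tau>) - \<alpha>" by simp
    ultimately show ?thesis by (simp only:)
  qed
  \<comment> \<open>Indices of the grid points of mesh \<open>\<eta>\<close> in the unit interval;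
    finitely many limits can be combined.\<close>
  define J where "J = {j::nat. real j * \<eta> \<le> 1}"
  have "j \<le> nat \<lceil>1 / \<eta>\<rceil>" if "j \<in> J" for j
  proof -
    have "real j \<le> 1 / \<eta>" using that \<eta> by (simp add: J_def field_simps)
    also have "\<dots> \<le> real (nat \<lceil>1 / \<eta>\<rceil>)" by (rule real_nat_ceiling_ge)
    finally show ?thesis by simp
  qed
  then have "J \<subseteq> {..nat \<lceil>1 / \<eta>\<rceil>}" by auto
  then have "finite J" using finite_subset by blast
  then have "\<forall>\<^sub>F t in at_top. \<forall>j\<in>J. \<bar>F t - F (t - real j * \<eta>)\<bar> < \<epsilon>"
  proof (rule eventually_ball_finite, intro ballI)
    fix j assume "j \<in> J"
    then have "real j * \<eta> \<in> {0..1}" using \<eta> by (simp add: J_def)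
    from tendstoD[OF lim[OF this] \<open>\<epsilon> > 0\<close>]
    show "\<forall>\<^sub>F t in at_top. \<bar>F t - F (t - real j * \<eta>)\<bar> < \<epsilon>" by simp
  qed
  \<comment> \<open>The threshold \<open>real n + 2\<close> gives
    \<open>t - \<theta> \<ge> real n + 1\<close>, as \<open>small\<close> requires.\<close>
  then show ?thesis
    using eventually_ge_at_top[of "real n + 2"]
  proof eventually_elim
    case (elim t)
    show ?case
    proof
      fix \<theta> :: real assume \<theta>: "\<theta> \<in> {0..1}"
      \<comment> \<open>The grid point just below \<open>\<theta>\<close> costs less than
        \<open>\<epsilon>\<close>, and the remaining shift of at most \<open>\<eta>\<close> costs at
        most \<open>2 * \<epsilon>\<close>; together they stay below \<open>e\<close>.\<close>
      define j where "j = nat \<lfloor>\<theta> / \<eta>\<rfloor>"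
      have "real j \<le> \<theta> / \<eta>" "\<theta> / \<eta> < real j + 1"
        using \<theta> \<eta> by (auto simp: j_def)
      then have j: "real j * \<eta> \<le> \<theta>" "\<theta> - real j * \<eta> \<le> \<eta>"
        using \<eta> by (simp_all add: field_simps)
      then have "j \<in> J" using \<theta> by (simp add: J_def)
      then have "\<bar>F t - F (t - real j * \<eta>)\<bar> < \<epsilon>" using elim(1) by blast
      moreover have "\<bar>F (t - real j * \<eta>) - F ((t - real j * \<eta>) - (\<theta> - real j * \<eta>))\<bar> \<le> 2 * \<epsilon>"
        using j elim(2) \<theta> by (intro small) auto
      moreover have "e = 4 * \<epsilon>" by (simp add: \<epsilon>_def)
      ultimately show "\<bar>F t - F (t - \<theta>)\<bar> < e" using \<open>\<epsilon> > 0\<close> by simp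
    qed
  qed
qed

lemma f_theta_pointwise_imp_uniform:
  assumes f: "f \<in> L1_loc {0..}" and lim: "\<And>\<theta>. \<theta> \<in> {0..1} \<Longrightarrow> (f_theta f \<theta> \<longlongrightarrow> 0) at_top"
  shows "uniform_limit {0..1} (\<lambda>t \<theta>. f_theta f \<theta> t) (\<lambda>\<theta>. 0) at_top"
  unfolding uniform_limit_iff
proof (intro allI impI)
  fix e :: real assume "e > 0"
  have "((\<lambda>t. primitive f t - primitive f (t - \<theta>)) \<longlongrightarrow> 0) at_top" if "\<theta> \<in> {0..1}" for \<theta>
    using lim[OF that]
  proof (rule Lim_transform_eventually)
    show "\<forall>\<^sub>F t in at_top. f_theta f \<theta> t = primitive f t - primitive f (t - \<theta>)"
      using eventually_ge_at_top[of \<theta>] by eventually_elim (use that f_theta_eq[OF f] in auto)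
  qed
  from differences_tendsto_0_uniformly[OF continuous_on_primitive[OF f] this \<open>e > 0\<close>]
  have "\<forall>\<^sub>F t in at_top. \<forall>\<theta>\<in>{0..1}. \<bar>primitive f t - primitive f (t - \<theta>)\<bar> < e" .
  then show "\<forall>\<^sub>F t in at_top. \<forall>\<theta>\<in>{0..1}. dist (f_theta f \<theta> t) 0 < e"
    using eventually_ge_at_top[of 1]
    by eventually_elim (use f_theta_eq[OF f] in auto)
qed

subsection \<open>The equivalence\<close>

theorem theorem2:
  fixes f :: "real \<Rightarrow> real" and a b :: real
  assumes "f \<in> L1_loc {0..}" and "a > 0" and "b > 0"
  shows
    "((\<forall>\<xi>0 \<xi>1. (ode_solution f a b \<xi>0 \<xi>1 \<longlongrightarrow> 0) at_top \<and>
                (deriv_ge0 (ode_solution f a b \<xi>0 \<xi>1) \<longlongrightarrow> 0) at_top)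
       \<longleftrightarrow> (y1 f \<longlongrightarrow> 0) at_top) \<and>
     ((y1 f \<longlongrightarrow> 0) at_top
       \<longleftrightarrow> uniform_limit {0..1} (\<lambda>t \<theta>. f_theta f \<theta> t) (\<lambda>\<theta>. 0) at_top) \<and>
     (uniform_limit {0..1} (\<lambda>t \<theta>. f_theta f \<theta> t) (\<lambda>\<theta>. 0) at_top
       \<longleftrightarrow> (\<forall>\<theta>\<in>{0..1}. (f_theta f \<theta> \<longlongrightarrow> 0) at_top))"
proof -
  note f = \<open>f \<in> L1_loc {0..}\<close> and ab = \<open>a > 0\<close> \<open>b > 0\<close>
  let ?smooth = "((\<lambda>t. primitive f t - lag f t) \<longlongrightarrow> 0) at_top"
  let ?unif = "uniform_limit {0..1} (\<lambda>t \<theta>. f_theta f \<theta> t) (\<lambda>\<theta>. 0) at_top"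
  have y1: "(y1 f \<longlongrightarrow> 0) at_top \<longleftrightarrow> ?smooth"
    by (intro tendsto_cong eventually_mono[OF eventually_ge_at_top[of 0]] y1_eq[OF f])
  have deriv: "(deriv_ge0 x \<longlongrightarrow> 0) at_top \<longleftrightarrow> ((\<lambda>t. r t + primitive f t) \<longlongrightarrow> 0) at_top"
    if "regular_system f a b x r" for x r
    by (intro tendsto_cong eventually_mono[OF eventually_ge_at_top[of 0]] regular_system_deriv_ge0[OF that])
  \<comment> \<open>The equivalence is proved for each pair of initial data separately, so
    convergence for one pair already forces it for all.\<close>
  have "(ode_solution f a b \<xi>0 \<xi>1 \<longlongrightarrow> 0) at_top \<and> (deriv_ge0 (ode_solution f a b \<xi>0 \<xi>1) \<longlongrightarrow> 0) at_top \<longleftrightarrow> ?smooth"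
    for \<xi>0 \<xi>1
  proof -
    obtain r where sys: "regular_system f a b (ode_solution f a b \<xi>0 \<xi>1) r"
      using ode_solution_regular_system[OF f ab] by blast
    show ?thesis
      unfolding deriv[OF sys]
      using regular_system_tendsto_0[OF f ab sys] regular_system_imp_smoothing_tendsto_0[OF f sys] by blast
  qed
  moreover have "?smooth \<longleftrightarrow> ?unif"
    using smoothing_tendsto_0_imp_f_theta_uniform[OF f] f_theta_uniform_imp_smoothing_tendsto_0[OF f] by blast
  moreover have "?unif \<longleftrightarrow> (\<forall>\<theta>\<in>{0..1}. (f_theta f \<theta> \<longlongrightarrow> 0) at_top)"
    using tendsto_uniform_limitI f_theta_pointwise_imp_uniform[OF f] by fastforce
  ultimately show ?thesis
    unfolding y1 by simp
qed

end
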